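(* Let $F = (f_1,\ldots,f_m)$ and $G = (g_1,\ldots,g_N)$ be lists of polynomials in $\mathbb{R}[x_1,\ldots,x_n]_{\leq 2}$ with $\dim(\mathcal{V}_{\mathbb{C}}(F)) = n-m$. If each polynomial in $G$ is an $\mathbb{R}$-linear combination of $f_1,\ldots,f_m$ and $\mathcal{I}(F) = \mathcal{I}(G)$, then $\mathcal{R}_F = \mathcal{R}_G$.
   Context: $\mathbb{R}[x_1,\ldots,x_n]_{\leq 2}$ is the set of real polynomials of degree at most $2$, and $\mathrm{Sym}_n(\mathbb{R})$ is the space of real symmetric $n\times n$ matrices. For a list $F=(f_1,\ldots,f_m)$ of real polynomials, $\mathcal{I}(F) = \{h_1f_1+\cdots+h_mf_m : h_i \in \mathbb{R}[x_1,\ldots,x_n]\}$ is the ideal it generates, $\mathcal{V}_{\mathbb{C}}(F) = \{x\in\mathbb{C}^n : f_1(x)=\cdots=f_m(x)=0\}$ and $\mathcal{V}_{\mathbb{R}}(F) = \{x\in\mathbb{R}^n : f_1(x)=\cdots=f_m(x)=0\}$. The dimension of a complex variety is its usual dimension (the maximal number of general hyperplanes whose common intersection with the variety is nonempty). SDP exact region: for a list $F=(f_1,\ldots,f_m)$ of polynomials in $\mathbb{R}[x_1,\ldots,x_n]_{\leq 2}$, write $f_i(x) = x^TA_ix + 2a_i^Tx + \alpha_i$ with $A_i \in \mathrm{Sym}_n(\mathbb{R})$, $a_i\in\mathbb{R}^n$, $\alpha_i\in\mathbb{R}$. For $C\in \mathrm{Sym}_n(\mathbb{R})$ and $\lambda\in\mathbb{R}^m$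 put $H(\lambda) = C - \sum_{i=1}^m\lambda_iA_i$. Then $$\mathcal{R}_F = \Big\{(C,c)\in \mathrm{Sym}_n(\mathbb{R})\times\mathbb{R}^n : H(\lambda)\succ 0 \text{ and } c - \sum_{i=1}^m\lambda_ia_i + H(\lambda)x = 0 \text{ for some } x\in\mathcal{V}_{\mathbb{R}}(F),\ \lambda\in\mathbb{R}^m\Big\},$$ where $\succ 0$ means positive definite. *)

theory Defs
  imports "HOL-Analysis.Analysis" "HOL-Library.Poly_Mapping"
begin

text \<open>
  A polynomial in the variables \<open>'v\<close> over \<open>'a\<close> is a finitely supported map from monomials
  (finitely supported exponent vectors) to coefficients; its ring structure is the one of
  \<open>HOL-Library.Poly_Mapping\<close>.  The ring of polynomials in \<open>n\<close> variables over the reals is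
  \<open>('n, real) mpoly\<close> with \<open>'n\<close> finite and \<open>n = CARD('n)\<close>.
\<close>

type_synonym ('v, 'a) mpoly = "('v \<Rightarrow>\<^sub>0 nat) \<Rightarrow>\<^sub>0 'a"

definition mpoly_eval :: "('v, 'a::comm_semiring_1) mpoly \<Rightarrow> ('v \<Rightarrow> 'a) \<Rightarrow> 'a" where
  "mpoly_eval p x =
     (\<Sum>m\<in>Poly_Mapping.keys p. Poly_Mapping.lookup p m *
        (\<Prod>v\<in>Poly_Mapping.keys m. x v ^ Poly_Mapping.lookup m v))"

definition mpoly_vars :: "('v, 'a::zero) mpoly \<Rightarrow> 'v set" where
  "mpoly_vars p = (\<Union>m\<in>Poly_Mapping.keys p. Poly_Mapping.keys m)"

definition mpoly_const :: "'a \<Rightarrow> ('v, 'a::zero) mpoly" where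
  "mpoly_const c = Poly_Mapping.single 0 c"

definition mpolys_deg_le :: "nat \<Rightarrow> ('v, 'a::zero) mpoly set" where
  "mpolys_deg_le d = {p. \<forall>m\<in>Poly_Mapping.keys p.
     (\<Sum>v\<in>Poly_Mapping.keys m. Poly_Mapping.lookup m v) \<le> d}"

definition gen_ideal :: "('v, 'a::comm_semiring_1) mpoly list \<Rightarrow> ('v, 'a) mpoly set" where
  "gen_ideal F = {\<Sum>i<length F. h i * F ! i | h. True}"

definition real_variety :: "('n::finite, real) mpoly list \<Rightarrow> (real ^ 'n) set" where
  "real_variety F = {x. \<forall>f\<in>set F. mpoly_eval f (\<lambda>i. x $ i) = 0}"

definition complex_variety :: "('n::finite, real) mpoly list \<Rightarrow> (complex ^ 'n) set" where
  "complex_variety F =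
     {x. \<forall>f\<in>set F. mpoly_eval (Poly_Mapping.map complex_of_real f) (\<lambda>i. x $ i) = 0}"

text \<open>
  \<open>Q\<close> holds for general points of the complex affine space with coordinates indexed by the
  finite set \<open>I\<close>: it holds on a nonempty Zariski-open set, equivalently outside the zero set of
  some nonzero polynomial in the coordinates from \<open>I\<close>.
\<close>

definition holds_generally :: "'v set \<Rightarrow> (('v \<Rightarrow> complex) \<Rightarrow> bool) \<Rightarrow> bool" where
  "holds_generally I Q \<longleftrightarrow>
     (\<exists>P :: ('v, complex) mpoly. P \<noteq> 0 \<and> mpoly_vars P \<subseteq> I \<and>
        (\<forall>u. mpoly_eval P u \<noteq> 0 \<longrightarrow> Q u))"

text \<open>
  The \<open>k\<close>-th affine hyperplane of a family with coefficients \<open>u\<close>: \<open>u (k, Some j)\<close> is the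
  coefficient of the \<open>j\<close>-th coordinate and \<open>u (k, None)\<close> is the constant term.  Coefficients with
  vanishing normal vector do not define a hyperplane, but they form a proper closed set and thus
  play no role in statements about general hyperplanes.
\<close>

definition hyperplane :: "(nat \<times> 'n option \<Rightarrow> complex) \<Rightarrow> nat \<Rightarrow> (complex ^ 'n::finite) set" where
  "hyperplane u k = {x. (\<Sum>j\<in>UNIV. u (k, Some j) * x $ j) + u (k, None) = 0}"

definition meets_general_hyperplanes :: "(complex ^ 'n::finite) set \<Rightarrow> nat \<Rightarrow> bool" where
  "meets_general_hyperplanes V d \<longleftrightarrow>
     holds_generally ({..<d} \<times> UNIV) (\<lambda>u. V \<inter> (\<Inter>k<d. hyperplane u k) \<noteq> {})"

text \<open>
  The set in the maximum is bounded by \<open>CARD('n)\<close>, and it contains \<open>0\<close> if \<open>V\<close> is nonempty.  The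
  empty variety gets dimension \<open>-1\<close>.
\<close>

definition variety_dim :: "(complex ^ 'n::finite) set \<Rightarrow> int" where
  "variety_dim V = (if V = {} then - 1 else int (Max {d. meets_general_hyperplanes V d}))"

text \<open>
  The data of \<open>f(x) = x\<^sup>T A x + 2 a\<^sup>T x + \<alpha>\<close> with \<open>A\<close> symmetric, read off from the coefficients of a
  polynomial \<open>f\<close> of degree at most 2; see \<open>mpoly_eval_quadratic\<close> below.
\<close>

definition quad_mat :: "('n::finite, real) mpoly \<Rightarrow> real ^ 'n ^ 'n" where
  "quad_mat f = (\<chi> i j.
     let c = Poly_Mapping.lookup f (Poly_Mapping.single i 1 + Poly_Mapping.single j 1)
     in if i = j then c else c / 2)"

definition quad_vec :: "('n::finite, real) mpoly \<Rightarrow> real ^ 'n" where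
  "quad_vec f = (\<chi> i. Poly_Mapping.lookup f (Poly_Mapping.single i 1) / 2)"

definition quad_const :: "('n::finite, real) mpoly \<Rightarrow> real" where
  "quad_const f = Poly_Mapping.lookup f 0"

definition symmetric_mat :: "real ^ 'n ^ 'n \<Rightarrow> bool" where
  "symmetric_mat A \<longleftrightarrow> transpose A = A"

definition pos_definite :: "real ^ 'n ^ 'n::finite \<Rightarrow> bool" where
  "pos_definite A \<longleftrightarrow> symmetric_mat A \<and> (\<forall>x. x \<noteq> 0 \<longrightarrow> x \<bullet> (A *v x) > 0)"

definition sdp_hessian ::
  "('n::finite, real) mpoly list \<Rightarrow> real ^ 'n ^ 'n \<Rightarrow> (nat \<Rightarrow> real) \<Rightarrow> real ^ 'n ^ 'n" where
  "sdp_hessian F C l = C - (\<Sum>i<length F. l i *\<^sub>R quad_mat (F ! i))"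

definition sdp_exact_region ::
  "('n::finite, real) mpoly list \<Rightarrow> ((real ^ 'n ^ 'n) \<times> (real ^ 'n)) set" where
  "sdp_exact_region F = {(C, c). symmetric_mat C \<and>
     (\<exists>x\<in>real_variety F. \<exists>l :: nat \<Rightarrow> real.
        pos_definite (sdp_hessian F C l) \<and>
        c - (\<Sum>i<length F. l i *\<^sub>R quad_vec (F ! i)) + sdp_hessian F C l *v x = 0)}"

lemma symmetric_quad_mat: "symmetric_mat (quad_mat f)"
  by (simp add: symmetric_mat_def quad_mat_def transpose_def vec_eq_iff Let_def add.commute)


lemma mpoly_eval_superset:
  fixes p :: "('v::finite, 'a::comm_semiring_1) mpoly"
  assumes "finite S" "Poly_Mapping.keys p \<subseteq> S"
  shows "mpoly_eval p x =
    (\<Sum>m\<in>S. Poly_Mapping.lookup p m * (\<Prod>v\<in>UNIV. x v ^ Poly_Mapping.lookup m v))"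
proof -
  have e: "(\<Prod>v\<in>Poly_Mapping.keys m. x v ^ Poly_Mapping.lookup m v) =
      (\<Prod>v\<in>UNIV. x v ^ Poly_Mapping.lookup m v)" for m :: "'v \<Rightarrow>\<^sub>0 nat"
    by (rule prod.mono_neutral_left) (auto simp: in_keys_iff)
  show ?thesis
    unfolding mpoly_eval_def e
    by (rule sum.mono_neutral_left) (use assms in \<open>auto simp: in_keys_iff\<close>)
qed

lemma mpoly_eval_add:
  fixes p q :: "('v::finite, 'a::comm_semiring_1) mpoly"
  shows "mpoly_eval (p + q) x = mpoly_eval p x + mpoly_eval q x"
proof -
  let ?S = "Poly_Mapping.keys p \<union> Poly_Mapping.keys q"
  have S: "finite ?S" "Poly_Mapping.keys (p + q) \<subseteq> ?S" "Poly_Mapping.keys p \<subseteq> ?S"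
    "Poly_Mapping.keys q \<subseteq> ?S"
    using keys_add[of p q] by auto
  show ?thesis
    unfolding mpoly_eval_superset[OF S(1,2)] mpoly_eval_superset[OF S(1,3)]
      mpoly_eval_superset[OF S(1,4)]
    by (simp add: lookup_add algebra_simps sum.distrib)
qed

lemma degree_le_2_cases:
  fixes m :: "'v::finite \<Rightarrow>\<^sub>0 nat"
  assumes "(\<Sum>v\<in>Poly_Mapping.keys m. Poly_Mapping.lookup m v) \<le> 2"
  obtains "m = 0" | i where "m = Poly_Mapping.single i 1"
  | i j where "m = Poly_Mapping.single i 1 + Poly_Mapping.single j 1"
proof -
  have ex: "\<exists>i m'. m = Poly_Mapping.single i 1 + m' \<and>
      (\<Sum>v\<in>UNIV. Poly_Mapping.lookup m v) = Suc (\<Sum>v\<in>UNIV. Poly_Mapping.lookup m' v)"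
    if "m \<noteq> 0" for m :: "'v \<Rightarrow>\<^sub>0 nat"
  proof -
    from that obtain i where i: "Poly_Mapping.lookup m i \<noteq> 0"
      by (metis lookup_zero poly_mapping_eqI)
    define m' where "m' = m - Poly_Mapping.single i 1"
    have m: "m = Poly_Mapping.single i 1 + m'"
      by (rule poly_mapping_eqI)
        (use i in \<open>auto simp: m'_def lookup_add lookup_minus lookup_single when_def\<close>)
    show ?thesis
      by (rule exI[of _ i], rule exI[of _ m'])
        (simp add: m lookup_add sum.distrib lookup_single when_def)
  qed
  have d: "(\<Sum>v\<in>UNIV. Poly_Mapping.lookup m v) \<le> 2"
    using assms by (subst sum.mono_neutral_right[of _ "Poly_Mapping.keys m"])
      (auto simp: in_keys_iff)
  show thesis
  proof (cases "m = 0")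
    case False
    then obtain i m' where m: "m = Poly_Mapping.single i 1 + m'"
      and d': "(\<Sum>v\<in>UNIV. Poly_Mapping.lookup m v) = Suc (\<Sum>v\<in>UNIV. Poly_Mapping.lookup m' v)"
      using ex by blast
    show thesis
    proof (cases "m' = 0")
      case True
      then show thesis using m that(2) by simp
    next
      case False
      then obtain j m'' where m': "m' = Poly_Mapping.single j 1 + m''"
        and d'': "(\<Sum>v\<in>UNIV. Poly_Mapping.lookup m' v) =
          Suc (\<Sum>v\<in>UNIV. Poly_Mapping.lookup m'' v)"
        using ex by blast
      have "m'' = 0"
        using ex[of m''] d d' d'' by fastforce
      then show thesis using m m' that(3) by simp
    qed
  qed (use that in blast)
qed

lemma mpoly_eval_quadratic:
  fixes f :: "('n::finite, real) mpoly"
  assumes "f \<in> mpolys_deg_le 2"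
  shows "mpoly_eval f (\<lambda>i. x $ i) =
    x \<bullet> (quad_mat f *v x) + 2 * (quad_vec f \<bullet> x) + quad_const f"
proof -
  define R where "R f = x \<bullet> (quad_mat f *v x) + 2 * (quad_vec f \<bullet> x) + quad_const f"
    for f :: "('n, real) mpoly"
  have mat_add: "quad_mat (f + g) = quad_mat f + quad_mat g" for f g :: "('n, real) mpoly"
    by (simp add: quad_mat_def vec_eq_iff lookup_add Let_def add_divide_distrib)
  have vec_add: "quad_vec (f + g) = quad_vec f + quad_vec g" for f g :: "('n, real) mpoly"
    by (simp add: quad_vec_def vec_eq_iff lookup_add add_divide_distrib)
  have R_add: "R (f + g) = R f + R g" for f g
    by (simp add: R_def mat_add vec_add quad_const_def lookup_add
        matrix_vector_mult_add_rdistrib inner_add_left inner_add_right)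
  have "quad_mat (0 :: ('n, real) mpoly) = 0" "quad_vec (0 :: ('n, real) mpoly) = 0"
    by (simp_all add: quad_mat_def quad_vec_def vec_eq_iff)
  then have R_0: "R 0 = 0"
    by (simp add: R_def quad_const_def)
  have E_0: "mpoly_eval (0 :: ('n, real) mpoly) (\<lambda>i. x $ i) = 0"
    by (simp add: mpoly_eval_def)
  have s1: "(Poly_Mapping.single a 1 :: 'n \<Rightarrow>\<^sub>0 nat) = Poly_Mapping.single b 1 \<longleftrightarrow> a = b" for a b
    by (metis lookup_single_eq lookup_single_not_eq zero_neq_one)
  have E_single: "mpoly_eval (Poly_Mapping.single m c :: ('n, real) mpoly) (\<lambda>i. x $ i) =
      c * (\<Prod>v\<in>UNIV. x $ v ^ Poly_Mapping.lookup m v)" for m c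
    by (subst mpoly_eval_superset[of "{m}"]) auto
  let ?s = "\<lambda>i. Poly_Mapping.single i 1 :: 'n \<Rightarrow>\<^sub>0 nat"
  have deg_single: "(\<Sum>v\<in>UNIV. Poly_Mapping.lookup (?s a) v) = 1" for a
    by (simp add: lookup_single when_def)
  have ne: "?s a \<noteq> 0" "0 \<noteq> ?s a" "?s a + ?s b \<noteq> 0" "0 \<noteq> ?s a + ?s b"
    "?s a + ?s b \<noteq> ?s d" "?s d \<noteq> ?s a + ?s b" for a b d
  proof -
    have z: "(\<Sum>v\<in>UNIV. Poly_Mapping.lookup (0 :: 'n \<Rightarrow>\<^sub>0 nat) v) = 0" by simp
    have t: "(\<Sum>v\<in>UNIV. Poly_Mapping.lookup (?s a + ?s b) v) = 2"
      using deg_single[of a] deg_single[of b] by (simp add: lookup_add sum.distrib)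
    show "?s a \<noteq> 0" "0 \<noteq> ?s a" "?s a + ?s b \<noteq> 0" "0 \<noteq> ?s a + ?s b"
      "?s a + ?s b \<noteq> ?s d" "?s d \<noteq> ?s a + ?s b"
      using z t deg_single[of a] deg_single[of d] by (metis zero_neq_one zero_neq_numeral
        one_eq_numeral_iff semiring_norm(85))+
  qed
  have s2: "?s a + ?s b = ?s i + ?s j \<longleftrightarrow> (a = i \<and> b = j) \<or> (a = j \<and> b = i)" for a b i j
  proof
    assume h: "?s a + ?s b = ?s i + ?s j"
    have l: "Poly_Mapping.lookup (?s a + ?s b) v = Poly_Mapping.lookup (?s i + ?s j) v" for v
      using h by simp
    show "(a = i \<and> b = j) \<or> (a = j \<and> b = i)"
      using l[of a] l[of b] l[of i] l[of j]
      by (auto simp: lookup_add lookup_single when_def split: if_splits)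
  qed (auto simp: add.commute)
  have pow1: "(\<Prod>v\<in>UNIV. x $ v ^ Poly_Mapping.lookup (?s i) v) = x $ i" for i
  proof -
    have "(\<Prod>v\<in>UNIV. x $ v ^ Poly_Mapping.lookup (?s i) v) = (\<Prod>v\<in>UNIV. if v = i then x $ v else 1)"
      by (rule prod.cong) (auto simp: lookup_single when_def)
    then show ?thesis by simp
  qed
  have single: "mpoly_eval (Poly_Mapping.single m c) (\<lambda>i. x $ i) = R (Poly_Mapping.single m c)"
    if "(\<Sum>v\<in>Poly_Mapping.keys m. Poly_Mapping.lookup m v) \<le> 2" for m c
    using that
  proof (cases m rule: degree_le_2_cases)
    case 1
    have q: "quad_mat (Poly_Mapping.single m c) = 0" "quad_vec (Poly_Mapping.single m c) = 0"
      using ne by (simp_all add: 1 quad_mat_def quad_vec_def lookup_single when_def Let_def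
          vec_eq_iff)
    show ?thesis
      unfolding E_single R_def q by (simp add: 1 quad_const_def)
  next
    case (2 i)
    have q: "quad_mat (Poly_Mapping.single m c) = 0" "quad_const (Poly_Mapping.single m c) = 0"
      using ne by (simp_all add: 2 quad_mat_def quad_const_def lookup_single when_def Let_def
          vec_eq_iff)
    have v: "quad_vec (Poly_Mapping.single m c) = (\<chi> a. if a = i then c / 2 else 0)"
      by (auto simp: 2 quad_vec_def lookup_single when_def vec_eq_iff s1[simplified])
    show ?thesis
      unfolding E_single R_def q v unfolding 2 pow1
      by (simp add: inner_vec_def if_distrib[of "\<lambda>t. t * _"] cong: if_cong)
  next
    case (3 i j)
    have q: "quad_vec (Poly_Mapping.single m c) = 0" "quad_const (Poly_Mapping.single m c) = 0"
      using ne by (simp_all add: 3 quad_vec_def quad_const_def lookup_single when_def Let_def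
          vec_eq_iff)
    have M: "quad_mat (Poly_Mapping.single m c) = (\<chi> a b.
        (if a = i then (if b = j then c / 2 else 0) else 0) +
        (if a = j then (if b = i then c / 2 else 0) else 0))"
      unfolding quad_mat_def lookup_single when_def 3
      by (auto simp: vec_eq_iff s2[simplified] Let_def)
    have sums: "(\<Sum>b\<in>UNIV. (if b = k then c / 2 else 0) * x $ b) = c / 2 * x $ k" for k
      by (simp add: if_distrib[of "\<lambda>t. t * _"] cong: if_cong)
    have Mx: "quad_mat (Poly_Mapping.single m c) *v x = (\<chi> a.
        (if a = i then c / 2 * x $ j else 0) + (if a = j then c / 2 * x $ i else 0))"
      unfolding M matrix_vector_mult_def
      by (auto simp: vec_eq_iff distrib_right sum.distrib sums)
    show ?thesis
      unfolding E_single R_def q Mx unfolding 3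
      by (simp add: lookup_add power_add prod.distrib pow1[simplified] inner_vec_def
          distrib_left sum.distrib if_distrib[of "\<lambda>t. _ * t"] cong: if_cong)
  qed
  have "mpoly_eval (\<Sum>m\<in>S. Poly_Mapping.single m (Poly_Mapping.lookup f m)) (\<lambda>i. x $ i) =
      R (\<Sum>m\<in>S. Poly_Mapping.single m (Poly_Mapping.lookup f m))"
    if "finite S" "S \<subseteq> Poly_Mapping.keys f" for S
    using that assms
    by (induction S) (auto simp: E_0 R_0 mpoly_eval_add R_add mpolys_deg_le_def intro!: single)
  moreover have "(\<Sum>m\<in>Poly_Mapping.keys f. Poly_Mapping.single m (Poly_Mapping.lookup f m)) = f"
    by (rule poly_mapping_eqI)
      (auto simp: lookup_sum lookup_single when_def in_keys_iff)
  ultimately show ?thesis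
    by (metis R_def finite_keys order_refl)
qed

end

theory Submission
  imports Defs "HOL-Library.Function_Algebras"
    "HOL-Computational_Algebra.Fundamental_Theorem_Algebra"
begin

text \<open>
  The matrices and vectors of a list enter its exact region only through the combinations
  \<open>\<Sum>\<lambda>\<^sub>i f\<^sub>i\<close> and through the real zeros.  So the region depends only on the linear span and on the
  real variety (\<open>sdp_exact_region_mono\<close>).  Equal ideals have equal varieties, and an empty real
  variety makes both regions empty.  What remains is to show that \<open>G\<close> spans the same space as \<open>F\<close>
  when there is a real, hence a complex, common zero.  If the span were smaller, a basis of it would
  be a list of \<open>k < m\<close> polynomials that cut out the same nonempty complex variety.  By Krull's
  height theorem that variety would have dimension at least \<open>n - k > n - m\<close>, against the hypothesis.

  For a dimension that is defined by general hyperplanes, the height theorem says that a nonempty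
  zero set of \<open>k < n\<close> polynomials meets \<open>n - k\<close> general hyperplanes
  (\<open>few_equations_meet_general_hyperplanes\<close>).  Its proof has three ingredients.

  \<^item> Counting (\<open>independent_coordinates_exist\<close>).  If \<open>k < n\<close> polynomials vanish at the origin, then some
    \<open>d = n - k\<close> coordinates satisfy no polynomial relation modulo the ideal \<open>I\<close> that they generate.
    Otherwise every \<open>d\<close> coordinates are related, so modulo \<open>I\<close> the monomials with fewer than \<open>d\<close> large
    exponents span everything.  With \<open>\<mm>\<close> the ideal of the origin, the quotient of the polynomial
    ring by \<open>I + \<mm>\<^sup>N\<close> then has dimension \<open>O(N\<^bsup>d-1\<^esup>)\<close>.  Dropping one generator costs a factor of at
    most \<open>N\<close>, so dropping all of them leaves \<open>O(N\<^bsup>n-1\<^esup>)\<close> for the quotient by \<open>\<mm>\<^sup>N\<close>, whose dimension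
    grows like \<open>N\<^sup>n\<close>.

  \<^item> Elimination (\<open>incidence_elimination\<close>).  In the ring of polynomials in the coordinates and in the
    coefficients of \<open>d\<close> hyperplanes, consider the ideal generated by the \<open>k\<close> polynomials and the \<open>d\<close>
    hyperplane equations.  It contains no nonzero \<open>D\<close> that involves the coefficients alone: after a
    generic affine change of coordinates, \<open>D\<close> would give a relation between every \<open>d\<close> coordinates.

  \<^item> Lifting (\<open>generic_point_of_ideal\<close>).  An ideal without nonzero elements that involve only the
    coefficients has zeros above all general coefficients.  This is the theorem of Chevalley that a
    dominant map hits a general point; it is proved by enlarging the ideal to a prime one and
    adjoining one coordinate at a time.
\<close>

section \<open>Evaluation of polynomials\<close>

definition monomial_val :: "('v \<Rightarrow>\<^sub>0 nat) \<Rightarrow> ('v \<Rightarrow> 'a::comm_semiring_1) \<Rightarrow> 'a" where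
  "monomial_val m x = (\<Prod>v\<in>Poly_Mapping.keys m. x v ^ Poly_Mapping.lookup m v)"

lemma monomial_val_superset:
  assumes "finite S" "Poly_Mapping.keys m \<subseteq> S"
  shows "monomial_val m x = (\<Prod>v\<in>S. x v ^ Poly_Mapping.lookup m v)"
  unfolding monomial_val_def
  by (rule prod.mono_neutral_left) (use assms in \<open>auto simp: in_keys_iff\<close>)

lemma monomial_val_add: "monomial_val (m + m') x = monomial_val m x * monomial_val m' x"
proof -
  let ?S = "Poly_Mapping.keys m \<union> Poly_Mapping.keys m'"
  have S: "finite ?S" "Poly_Mapping.keys (m + m') \<subseteq> ?S" "Poly_Mapping.keys m \<subseteq> ?S"
    "Poly_Mapping.keys m' \<subseteq> ?S"
    using keys_add[of m m'] by auto
  show ?thesis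
    unfolding monomial_val_superset[OF S(1,2)] monomial_val_superset[OF S(1,3)]
      monomial_val_superset[OF S(1,4)]
    by (simp add: lookup_add power_add prod.distrib)
qed

lemma monomial_val_0 [simp]: "monomial_val 0 x = 1"
  by (simp add: monomial_val_def)

lemma mpoly_sum_of_terms:
  fixes p :: "('v, 'a::comm_monoid_add) mpoly"
  shows "(\<Sum>m\<in>Poly_Mapping.keys p. Poly_Mapping.single m (Poly_Mapping.lookup p m)) = p"
  by (rule poly_mapping_eqI) (auto simp: lookup_sum lookup_single when_def in_keys_iff)

lemma mpoly_induct [case_names zero single add]:
  fixes p :: "('v, 'a::comm_monoid_add) mpoly"
  assumes "P 0" "\<And>m c. P (Poly_Mapping.single m c)" "\<And>p q. P p \<Longrightarrow> P q \<Longrightarrow> P (p + q)"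
  shows "P p"
proof -
  have "P (\<Sum>m\<in>S. Poly_Mapping.single m (Poly_Mapping.lookup p m))" if "finite S" for S
    using that by induction (auto intro: assms)
  then show ?thesis
    using mpoly_sum_of_terms[of p] by (metis finite_keys)
qed

text \<open>Real polynomials are evaluated at real and at complex points.  Evaluation along a homomorphism of
  the coefficients covers both, so that its ring laws are proved once.\<close>

locale coefficient_hom =
  fixes \<phi> :: "'a::comm_ring_1 \<Rightarrow> 'b::comm_ring_1"
  assumes hom_0: "\<phi> 0 = 0"
    and hom_1: "\<phi> 1 = 1"
    and hom_add: "\<phi> (a + b) = \<phi> a + \<phi> b"
    and hom_mult: "\<phi> (a * b) = \<phi> a * \<phi> b"
begin

definition ev :: "('v, 'a) mpoly \<Rightarrow> ('v \<Rightarrow> 'b) \<Rightarrow> 'b" where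
  "ev p x = (\<Sum>m\<in>Poly_Mapping.keys p. \<phi> (Poly_Mapping.lookup p m) * monomial_val m x)"

lemma ev_superset:
  assumes "finite S" "Poly_Mapping.keys p \<subseteq> S"
  shows "ev p x = (\<Sum>m\<in>S. \<phi> (Poly_Mapping.lookup p m) * monomial_val m x)"
  unfolding ev_def by (rule sum.mono_neutral_left) (use assms in \<open>auto simp: in_keys_iff hom_0\<close>)

lemma ev_single [simp]: "ev (Poly_Mapping.single m c) x = \<phi> c * monomial_val m x"
  by (subst ev_superset[of "{m}"]) auto

lemma ev_0 [simp]: "ev 0 x = 0"
  by (simp add: ev_def)

lemma ev_const [simp]: "ev (mpoly_const c) x = \<phi> c"
  by (simp add: mpoly_const_def)

lemma ev_add: "ev (p + q) x = ev p x + ev q x"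
proof -
  let ?S = "Poly_Mapping.keys p \<union> Poly_Mapping.keys q"
  have S: "finite ?S" "Poly_Mapping.keys (p + q) \<subseteq> ?S" "Poly_Mapping.keys p \<subseteq> ?S"
    "Poly_Mapping.keys q \<subseteq> ?S"
    using keys_add[of p q] by auto
  show ?thesis
    unfolding ev_superset[OF S(1,2)] ev_superset[OF S(1,3)] ev_superset[OF S(1,4)]
    by (simp add: lookup_add hom_add algebra_simps sum.distrib)
qed

lemma ev_mult: "ev (p * q) x = ev p x * ev q x"
proof (induction p rule: mpoly_induct)
  case (single m c)
  show ?case
  proof (induction q rule: mpoly_induct)
    case (single m' c')
    show ?case by (simp add: mult_single monomial_val_add hom_mult mult_ac)
  next
    case (add p q)
    then show ?case by (simp only: distrib_left ev_add)
  qed simp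
next
  case (add p q)
  then show ?case by (simp only: distrib_right ev_add)
qed simp

lemma ev_sum: "ev (sum f A) x = (\<Sum>a\<in>A. ev (f a) x)"
  by (induction A rule: infinite_finite_induct) (auto simp: ev_add)

end

interpretation idh: coefficient_hom "\<lambda>c::'a::comm_ring_1. c"
  by unfold_locales (rule refl)+

interpretation cxh: coefficient_hom complex_of_real
  by unfold_locales (rule of_real_0 of_real_1 of_real_add of_real_mult)+

lemma mpoly_eval_eq_ev: "mpoly_eval p x = idh.ev p x"
  for p :: "('v, 'a::comm_ring_1) mpoly"
  by (simp add: mpoly_eval_def idh.ev_def monomial_val_def)

lemma mpoly_eval_complexify: "mpoly_eval (Poly_Mapping.map complex_of_real p) x = cxh.ev p x"
proof -
  have l: "Poly_Mapping.lookup (Poly_Mapping.map complex_of_real p) m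
      = complex_of_real (Poly_Mapping.lookup p m)" for m
    by (simp add: Poly_Mapping.map.rep_eq when_def)
  have "Poly_Mapping.keys (Poly_Mapping.map complex_of_real p) = Poly_Mapping.keys p"
    by (auto simp: in_keys_iff l)
  then show ?thesis
    by (simp add: mpoly_eval_def cxh.ev_def monomial_val_def l)
qed

section \<open>Polynomial functions on complex affine space\<close>

text \<open>Over an infinite field, polynomials and polynomial functions are the same thing.  Functions make
  substitutions and specializations immediate, and they still form a commutative ring.  Formal
  polynomials are used where coefficients have to be counted.\<close>

inductive_set polyfun :: "'v set \<Rightarrow> (('v \<Rightarrow> complex) \<Rightarrow> complex) set" for S where
  const: "(\<lambda>_. c) \<in> polyfun S"
| coord: "v \<in> S \<Longrightarrow> (\<lambda>x. x v) \<in> polyfun S"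
| add: "f \<in> polyfun S \<Longrightarrow> g \<in> polyfun S \<Longrightarrow> (\<lambda>x. f x + g x) \<in> polyfun S"
| mult: "f \<in> polyfun S \<Longrightarrow> g \<in> polyfun S \<Longrightarrow> (\<lambda>x. f x * g x) \<in> polyfun S"

lemma polyfun_uminus: "f \<in> polyfun S \<Longrightarrow> (\<lambda>x. - f x) \<in> polyfun S"
  using polyfun.mult[OF polyfun.const[of "-1"]] by simp

lemma polyfun_diff: "f \<in> polyfun S \<Longrightarrow> g \<in> polyfun S \<Longrightarrow> (\<lambda>x. f x - g x) \<in> polyfun S"
  using polyfun.add[OF _ polyfun_uminus] by simp

lemma polyfun_sum:
  "(\<And>a. a \<in> A \<Longrightarrow> f a \<in> polyfun S) \<Longrightarrow> (\<lambda>x. \<Sum>a\<in>A. f a x) \<in> polyfun S"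
  by (induction A rule: infinite_finite_induct) (auto intro: polyfun.intros)

lemma polyfun_prod:
  "(\<And>a. a \<in> A \<Longrightarrow> f a \<in> polyfun S) \<Longrightarrow> (\<lambda>x. \<Prod>a\<in>A. f a x) \<in> polyfun S"
  by (induction A rule: infinite_finite_induct) (auto intro: polyfun.intros)

lemma polyfun_power: "f \<in> polyfun S \<Longrightarrow> (\<lambda>x. f x ^ k) \<in> polyfun S"
  by (induction k) (auto intro: polyfun.intros)

lemmas polyfun_intros =
  polyfun.intros polyfun_uminus polyfun_diff polyfun_sum polyfun_prod polyfun_power

lemma polyfun_subst:
  assumes "f \<in> polyfun S" "\<And>v. v \<in> S \<Longrightarrow> (\<lambda>w. \<sigma> w v) \<in> polyfun T"
  shows "(\<lambda>w. f (\<sigma> w)) \<in> polyfun T"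
  using assms(1) by induction (auto intro: polyfun.intros assms(2))

lemma polyfun_mono: "S \<subseteq> T \<Longrightarrow> polyfun S \<subseteq> polyfun T"
  using polyfun_subst[of _ S "\<lambda>w. w" T] by (auto intro: polyfun.coord)

lemma polyfun_cong:
  assumes "f \<in> polyfun S" "\<And>v. v \<in> S \<Longrightarrow> x v = y v"
  shows "f x = f y"
  using assms(1) by induction (auto simp: assms(2))

lemma polyfun_det:
  fixes M :: "('v \<Rightarrow> complex) \<Rightarrow> complex ^ 'n::finite ^ 'n"
  assumes "\<And>i j. (\<lambda>x. M x $ i $ j) \<in> polyfun S"
  shows "(\<lambda>x. det (M x)) \<in> polyfun S"
  unfolding det_def by (intro polyfun_intros assms)

lemma polyfun_on_line:
  assumes "f \<in> polyfun S"
  shows "\<exists>p. \<forall>s. f (\<lambda>v. a v + s * b v) = poly p s"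
  using assms
proof induction
  case (const c)
  show ?case by (rule exI[of _ "[:c:]"]) simp
next
  case (coord v)
  show ?case by (rule exI[of _ "[:a v, b v:]"]) simp
next
  case (add f g)
  then show ?case by (metis poly_add)
next
  case (mult f g)
  then show ?case by (metis poly_mult)
qed

text \<open>On the line through a non-zero of \<open>f\<close> and a non-zero of \<open>g\<close>, both are nonzero polynomials in one
  variable, and so is their product.\<close>

lemma polyfun_common_nonzero:
  assumes f: "f \<in> polyfun S" "f x \<noteq> 0" and g: "g \<in> polyfun S'" "g y \<noteq> 0"
  shows "\<exists>z. f z \<noteq> 0 \<and> g z \<noteq> 0"
proof -
  obtain p where p: "\<And>s. f (\<lambda>v. x v + s * (y v - x v)) = poly p s"
    using polyfun_on_line[OF f(1), of x "\<lambda>v. y v - x v"] by blast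
  obtain q where q: "\<And>s. g (\<lambda>v. x v + s * (y v - x v)) = poly q s"
    using polyfun_on_line[OF g(1), of x "\<lambda>v. y v - x v"] by blast
  have "p \<noteq> 0" using p[of 0] f(2) by auto
  moreover have "q \<noteq> 0" using q[of 1] g(2) by auto
  ultimately have "p * q \<noteq> 0" by simp
  then obtain s where "poly (p * q) s \<noteq> 0"
    using poly_all_0_iff_0 by blast
  then show ?thesis using p q by (metis mult_eq_0_iff poly_mult)
qed

lemma polyfun_common_nonzero_finite:
  assumes "finite A" "\<And>a. a \<in> A \<Longrightarrow> f a \<in> polyfun S" "\<And>a. a \<in> A \<Longrightarrow> \<exists>x. f a x \<noteq> 0"
  shows "\<exists>z. \<forall>a\<in>A. f a z \<noteq> 0"
proof -
  have "\<exists>z. (\<Prod>a\<in>A. f a z) \<noteq> 0"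
    using assms
  proof (induction A)
    case (insert a A)
    have "(\<lambda>x. \<Prod>a\<in>A. f a x) \<in> polyfun S"
      by (rule polyfun_prod) (use insert in auto)
    moreover obtain y where "(\<Prod>a\<in>A. f a y) \<noteq> 0"
      using insert by (metis insertCI)
    moreover obtain x where "f a x \<noteq> 0"
      using insert.prems(2) by blast
    moreover have "f a \<in> polyfun S" using insert.prems(1) by blast
    ultimately obtain z where "f a z \<noteq> 0 \<and> (\<Prod>a\<in>A. f a z) \<noteq> 0"
      using polyfun_common_nonzero by blast
    then show ?case
      unfolding prod.insert[OF insert.hyps] by (intro exI[of _ z]) simp
  qed auto
  then show ?thesis using assms(1) by (metis prod_zero)
qed

lemma mpoly_vars_add: "mpoly_vars (p + q) \<subseteq> mpoly_vars p \<union> mpoly_vars q"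
  using keys_add[of p q] by (auto simp: mpoly_vars_def)

lemma mpoly_vars_mult: "mpoly_vars (p * q) \<subseteq> mpoly_vars p \<union> mpoly_vars q"
  for p q :: "('v, 'a::comm_ring_1) mpoly"
proof
  fix v assume "v \<in> mpoly_vars (p * q)"
  then obtain m where m: "m \<in> Poly_Mapping.keys (p * q)" "v \<in> Poly_Mapping.keys m"
    by (auto simp: mpoly_vars_def)
  then obtain a b where "m = a + b" "a \<in> Poly_Mapping.keys p" "b \<in> Poly_Mapping.keys q"
    using keys_mult[of p q] by blast
  then show "v \<in> mpoly_vars p \<union> mpoly_vars q"
    using m keys_add[of a b] by (auto simp: mpoly_vars_def)
qed

lemma polyfun_imp_mpoly:
  fixes f :: "('v \<Rightarrow> complex) \<Rightarrow> complex"
  assumes "f \<in> polyfun S"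
  shows "\<exists>p. mpoly_vars p \<subseteq> S \<and> (\<forall>x. f x = mpoly_eval p x)"
  using assms
proof induction
  case (const c)
  show ?case
    by (rule exI[of _ "mpoly_const c"])
      (auto simp: mpoly_eval_eq_ev mpoly_const_def mpoly_vars_def split: if_splits)
next
  case (coord v)
  have "monomial_val (Poly_Mapping.single v 1) x = x v" for v :: 'v and x :: "'v \<Rightarrow> complex"
    by (simp add: monomial_val_def)
  then show ?case
    by (intro exI[of _ "Poly_Mapping.single (Poly_Mapping.single v 1) 1"])
      (use coord in \<open>auto simp: mpoly_eval_eq_ev mpoly_vars_def\<close>)
next
  case (add f g)
  then obtain p q where "mpoly_vars p \<subseteq> S" "\<And>x. f x = mpoly_eval p x"
    "mpoly_vars q \<subseteq> S" "\<And>x. g x = mpoly_eval q x" by auto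
  then show ?case
    by (intro exI[of _ "p + q"])
      (use mpoly_vars_add[of p q] in \<open>auto simp: mpoly_eval_eq_ev idh.ev_add\<close>)
next
  case (mult f g)
  then obtain p q where "mpoly_vars p \<subseteq> S" "\<And>x. f x = mpoly_eval p x"
    "mpoly_vars q \<subseteq> S" "\<And>x. g x = mpoly_eval q x" by auto
  then show ?case
    by (intro exI[of _ "p * q"])
      (use mpoly_vars_mult[of p q] in \<open>auto simp: mpoly_eval_eq_ev idh.ev_mult\<close>)
qed

lemma ev_polyfun:
  assumes "mpoly_vars p \<subseteq> S"
  shows "cxh.ev p \<in> polyfun S"
  unfolding cxh.ev_def monomial_val_def
  by (intro polyfun_intros) (use assms in \<open>auto simp: mpoly_vars_def\<close>)

lemma mpoly_eval_polyfun:
  assumes "mpoly_vars p \<subseteq> S"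
  shows "mpoly_eval p \<in> polyfun S"
  unfolding mpoly_eval_def
  by (intro polyfun_intros) (use assms in \<open>auto simp: mpoly_vars_def\<close>)

lemma base_digits_less:
  fixes a :: "nat \<Rightarrow> nat"
  assumes "\<And>i. i < n \<Longrightarrow> a i < B"
  shows "(\<Sum>i<n. a i * B ^ i) < B ^ n"
  using assms
proof (induction n)
  case (Suc n)
  have "a n * B ^ n \<le> (B - 1) * B ^ n"
    using Suc.prems[of n] by (intro mult_right_mono) auto
  moreover have "(\<Sum>i<n. a i * B ^ i) < B ^ n" using Suc by simp
  moreover have "B ^ Suc n = (B - 1) * B ^ n + B ^ n"
    using Suc.prems[of n] by (cases B) auto
  ultimately show ?case unfolding sum.lessThan_Suc by linarith
qed auto

lemma base_digits_unique:
  fixes a b :: "nat \<Rightarrow> nat"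
  assumes "\<And>i. i < n \<Longrightarrow> a i < B" "\<And>i. i < n \<Longrightarrow> b i < B"
    and "(\<Sum>i<n. a i * B ^ i) = (\<Sum>i<n. b i * B ^ i)" "j < n"
  shows "a j = b j"
  using assms
proof (induction n)
  case (Suc n)
  have "(\<Sum>i<n. a i * B ^ i) < B ^ n" "(\<Sum>i<n. b i * B ^ i) < B ^ n"
    using base_digits_less Suc.prems by auto
  moreover have "(\<Sum>i<n. a i * B ^ i) + a n * B ^ n = (\<Sum>i<n. b i * B ^ i) + b n * B ^ n"
    using Suc.prems by simp
  moreover have "(r + k * B ^ n) div B ^ n = k" if "r < B ^ n" for r k
    using that div_mult_self1[of "B ^ n" r k] by (metis add.right_neutral div_less not_less_zero)
  ultimately have "a n = b n" by metis
  then show ?case using Suc by (auto simp: less_Suc_eq)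
qed auto

text \<open>If all exponents are below \<open>B\<close>, they are the digits of the weight in base \<open>B\<close>.  So the weight is
  an additive grading that separates such monomials.  It serves both as a substitute for a monomial
  order and, in the form \<open>x\<^sub>v = t ^ (B ^ idx v)\<close>, to reduce to polynomials in one variable.\<close>

definition weight :: "('v \<Rightarrow> nat) \<Rightarrow> nat \<Rightarrow> ('v \<Rightarrow>\<^sub>0 nat) \<Rightarrow> nat" where
  "weight idx B m = (\<Sum>v\<in>Poly_Mapping.keys m. Poly_Mapping.lookup m v * B ^ idx v)"

lemma weight_superset:
  assumes "finite S" "Poly_Mapping.keys m \<subseteq> S"
  shows "weight idx B m = (\<Sum>v\<in>S. Poly_Mapping.lookup m v * B ^ idx v)"
  unfolding weight_def
  by (rule sum.mono_neutral_left) (use assms in \<open>auto simp: in_keys_iff\<close>)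

lemma weight_add: "weight idx B (m + m') = weight idx B m + weight idx B m'"
proof -
  let ?S = "Poly_Mapping.keys m \<union> Poly_Mapping.keys m'"
  have S: "finite ?S" "Poly_Mapping.keys (m + m') \<subseteq> ?S" "Poly_Mapping.keys m \<subseteq> ?S"
    "Poly_Mapping.keys m' \<subseteq> ?S"
    using keys_add[of m m'] by auto
  show ?thesis
    unfolding weight_superset[OF S(1,2)] weight_superset[OF S(1,3)] weight_superset[OF S(1,4)]
    by (simp add: lookup_add algebra_simps sum.distrib)
qed

lemma weight_inj:
  assumes idx: "bij_betw idx V {..<n::nat}"
    and V: "Poly_Mapping.keys m \<subseteq> V" "Poly_Mapping.keys m' \<subseteq> V"
    and B: "\<And>v. Poly_Mapping.lookup m v < B" "\<And>v. Poly_Mapping.lookup m' v < B"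
    and eq: "weight idx B m = weight idx B m'"
  shows "m = m'"
proof (rule poly_mapping_eqI)
  fix v
  have fin: "finite V" using idx by (simp add: bij_betw_finite)
  define g where "g = inv_into V idx"
  have g: "bij_betw g {..<n} V"
    unfolding g_def using idx by (rule bij_betw_inv_into)
  have ig: "idx (g i) = i" if "i < n" for i
    unfolding g_def using idx that by (simp add: bij_betw_inv_into_right)
  have w: "weight idx B m = (\<Sum>i<n. Poly_Mapping.lookup m (g i) * B ^ i)"
    if "Poly_Mapping.keys m \<subseteq> V" for m
    unfolding weight_superset[OF fin that]
    by (subst sum.reindex_bij_betw[OF g, symmetric]) (simp add: ig)
  show "Poly_Mapping.lookup m v = Poly_Mapping.lookup m' v"
  proof (cases "v \<in> V")
    case True
    then obtain j where "j < n" "v = g j"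
      using g by (auto simp: bij_betw_def)
    then show ?thesis
      using base_digits_unique[of n "\<lambda>i. Poly_Mapping.lookup m (g i)" B
          "\<lambda>i. Poly_Mapping.lookup m' (g i)" j] B eq w[OF V(1)] w[OF V(2)] by simp
  next
    case False
    then show ?thesis using V by (metis in_keys_iff subsetD)
  qed
qed

lemma exponents_bounded:
  fixes A :: "('v \<Rightarrow>\<^sub>0 nat) set"
  assumes "finite A"
  shows "\<exists>B>0. \<forall>m\<in>A. \<forall>v. Poly_Mapping.lookup m v < B"
proof -
  let ?E = "\<Union>m\<in>A. Poly_Mapping.lookup m ` Poly_Mapping.keys m"
  have fin: "finite ?E" using assms by auto
  have "Poly_Mapping.lookup m v \<le> Max (insert 0 ?E)" if "m \<in> A" for m v
  proof (cases "v \<in> Poly_Mapping.keys m")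
    case True
    then show ?thesis using fin that by (intro Max_ge) auto
  qed (simp add: in_keys_iff)
  then show ?thesis by (intro exI[of _ "Suc (Max (insert 0 ?E))"]) (auto simp: less_Suc_eq_le)
qed

text \<open>This is Kronecker's substitution: \<open>x\<^sub>v = t ^ (B ^ idx v)\<close> sends distinct monomials of \<open>p\<close> to
  distinct powers of \<open>t\<close>.\<close>

lemma mpoly_eval_nonzero:
  fixes p :: "('v, complex) mpoly"
  assumes "p \<noteq> 0"
  shows "\<exists>x. mpoly_eval p x \<noteq> 0"
proof -
  have fin: "finite (mpoly_vars p)" by (auto simp: mpoly_vars_def)
  obtain idx where idx: "bij_betw idx (mpoly_vars p) {..<card (mpoly_vars p)}"
    using ex_bij_betw_finite_nat[OF fin] by (auto simp: atLeast0LessThan)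
  obtain B where B: "\<And>m v. m \<in> Poly_Mapping.keys p \<Longrightarrow> Poly_Mapping.lookup m v < B"
    using exponents_bounded[of "Poly_Mapping.keys p"] by auto
  define q where "q = (\<Sum>m\<in>Poly_Mapping.keys p. monom (Poly_Mapping.lookup p m) (weight idx B m))"
  have q: "poly q t = mpoly_eval p (\<lambda>v. t ^ (B ^ idx v))" for t
  proof -
    have "monomial_val m (\<lambda>v. t ^ (B ^ idx v)) = t ^ weight idx B m" for m
      by (simp add: monomial_val_def weight_def power_sum mult.commute flip: power_mult)
    then show ?thesis
      by (simp add: q_def poly_sum poly_monom mpoly_eval_eq_ev idh.ev_def)
  qed
  obtain m where m: "m \<in> Poly_Mapping.keys p" using assms by (metis all_not_in_conv keys_eq_empty)
  have vars: "Poly_Mapping.keys m' \<subseteq> mpoly_vars p" if "m' \<in> Poly_Mapping.keys p" for m'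
    using that by (auto simp: mpoly_vars_def)
  have "weight idx B m' = weight idx B m \<longleftrightarrow> m' = m" if "m' \<in> Poly_Mapping.keys p" for m'
    using weight_inj[OF idx vars[OF that] vars[OF m]] B that m by metis
  then have "coeff q (weight idx B m) = (\<Sum>m'\<in>Poly_Mapping.keys p.
      if m' = m then Poly_Mapping.lookup p m' else 0)"
    unfolding q_def coeff_sum by (intro sum.cong) auto
  also have "\<dots> = Poly_Mapping.lookup p m" using m by simp
  also have "\<dots> \<noteq> 0" using m by (simp add: in_keys_iff)
  finally have "q \<noteq> 0" by auto
  then show ?thesis using q poly_all_0_iff_0 by metis
qed

section \<open>Coordinates that are independent modulo few polynomials\<close>

text \<open>Ideals are taken relative to a subset \<open>R\<close>, because the relevant rings are the subrings
  \<open>polyfun S\<close> of one ring of functions.\<close>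

definition ideal_on :: "'r::comm_ring_1 set \<Rightarrow> 'r set \<Rightarrow> bool" where
  "ideal_on R Q \<longleftrightarrow> Q \<subseteq> R \<and> 0 \<in> Q \<and> (\<forall>a\<in>Q. \<forall>b\<in>Q. a + b \<in> Q) \<and> (\<forall>r\<in>R. \<forall>a\<in>Q. r * a \<in> Q)"

lemma ideal_onD:
  assumes "ideal_on R Q"
  shows "Q \<subseteq> R" "0 \<in> Q" "a \<in> Q \<Longrightarrow> b \<in> Q \<Longrightarrow> a + b \<in> Q" "r \<in> R \<Longrightarrow> a \<in> Q \<Longrightarrow> r * a \<in> Q"
  using assms by (auto simp: ideal_on_def)

lemma ideal_on_diff:
  assumes "ideal_on R Q" "-1 \<in> R" "a \<in> Q" "b \<in> Q"
  shows "a - b \<in> Q"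
  using ideal_onD(3)[OF assms(1,3) ideal_onD(4)[OF assms(1,2,4)]] by simp

lemma ideal_on_sum:
  assumes "ideal_on R Q" "\<And>x. x \<in> A \<Longrightarrow> f x \<in> Q"
  shows "sum f A \<in> Q"
  using assms(2) by (induction A rule: infinite_finite_induct) (auto intro: ideal_onD[OF assms(1)])

lemma ideal_on_gen_ideal: "ideal_on UNIV (gen_ideal gs)"
  for gs :: "('v, 'a::comm_ring_1) mpoly list"
  unfolding ideal_on_def
proof (intro conjI ballI)
  show "0 \<in> gen_ideal gs"
    unfolding gen_ideal_def by (rule CollectI, rule exI[of _ "\<lambda>_. 0"]) simp
next
  fix a b assume "a \<in> gen_ideal gs" "b \<in> gen_ideal gs"
  then obtain h h' where "a = (\<Sum>i<length gs. h i * gs ! i)" "b = (\<Sum>i<length gs. h' i * gs ! i)"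
    by (auto simp: gen_ideal_def)
  then have "a + b = (\<Sum>i<length gs. (h i + h' i) * gs ! i)"
    by (simp add: distrib_right sum.distrib)
  then show "a + b \<in> gen_ideal gs" by (auto simp: gen_ideal_def intro!: exI[of _ "\<lambda>i. h i + h' i"])
next
  fix a r assume "a \<in> gen_ideal gs"
  then obtain h where "a = (\<Sum>i<length gs. h i * gs ! i)"
    by (auto simp: gen_ideal_def)
  then have "r * a = (\<Sum>i<length gs. (r * h i) * gs ! i)"
    by (simp add: sum_distrib_left mult.assoc)
  then show "r * a \<in> gen_ideal gs" by (auto simp: gen_ideal_def intro!: exI[of _ "\<lambda>i. r * h i"])
qed auto

lemma gen_ideal_subset:
  assumes "ideal_on UNIV A" "set gs \<subseteq> A"
  shows "gen_ideal gs \<subseteq> A"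
proof
  fix f assume "f \<in> gen_ideal gs"
  then obtain h where "f = (\<Sum>i<length gs. h i * gs ! i)"
    by (auto simp: gen_ideal_def)
  then show "f \<in> A"
    using assms by (auto intro!: ideal_on_sum ideal_onD(4))
qed

lemma lookup_const_mult:
  fixes p :: "('v, 'a::comm_ring_1) mpoly"
  shows "Poly_Mapping.lookup (mpoly_const c * p) m = c * Poly_Mapping.lookup p m"
proof (induction p rule: mpoly_induct)
  case (single m' a)
  show ?case by (auto simp: mpoly_const_def mult_single lookup_single when_def)
next
  case (add p q)
  then show ?case by (simp add: distrib_left lookup_add)
qed simp

definition mscale :: "'a \<Rightarrow> ('v, 'a::comm_ring_1) mpoly \<Rightarrow> ('v, 'a) mpoly" where
  "mscale c p = mpoly_const c * p"

lemma lookup_mscale [simp]: "Poly_Mapping.lookup (mscale c p) m = c * Poly_Mapping.lookup p m"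
  by (simp add: mscale_def lookup_const_mult)

interpretation mpv: vector_space "mscale :: 'a::field \<Rightarrow> ('v, 'a) mpoly \<Rightarrow> ('v, 'a) mpoly"
  by unfold_locales (auto intro!: poly_mapping_eqI simp: lookup_add algebra_simps)

lemma span_mult_image:
  assumes "s \<in> mpv.span S"
  shows "t * s \<in> mpv.span ((\<lambda>s. t * s) ` S)"
  using assms
proof (induction rule: mpv.span_induct_alt)
  case base
  show ?case by (simp add: mpv.span_zero)
next
  case (step c x y)
  have "t * (mscale c x + y) = mscale c (t * x) + t * y"
    by (simp add: mscale_def algebra_simps)
  then show ?case
    using step by (auto intro!: mpv.span_add mpv.span_scale intro: mpv.span_base)
qed

text \<open>Writing \<open>f = s + h * g\<close> modulo \<open>A\<close> with \<open>s\<close> in the span, and treating the quotient \<open>h\<close> in the same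
  way, gives an expansion of \<open>f\<close> in powers of \<open>g\<close>, which ends at \<open>g ^ N\<close>.\<close>

lemma span_mod_ideal_eliminate_generator:
  fixes g :: "('v, 'a::field) mpoly"
  assumes A: "ideal_on UNIV A" and gN: "g ^ N \<in> A"
    and cover: "\<And>f. \<exists>s\<in>mpv.span S. \<exists>h. f - s - h * g \<in> A"
  shows "\<exists>s\<in>mpv.span ((\<lambda>(i, s). g ^ i * s) ` ({..<N} \<times> S)). f - s \<in> A"
proof -
  let ?S = "\<lambda>r. (\<lambda>(i, s). g ^ i * s) ` ({..<r} \<times> S)"
  have "\<exists>s\<in>mpv.span (?S r). \<exists>h. f - s - h * g ^ r \<in> A" for r
  proof (induction r)
    case 0
    show ?case by (intro bexI[of _ 0] exI[of _ f]) (auto simp: ideal_onD[OF A] mpv.span_zero)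
  next
    case (Suc r)
    then obtain s h where s: "s \<in> mpv.span (?S r)" "f - s - h * g ^ r \<in> A" by blast
    obtain s' h' where s': "s' \<in> mpv.span S" "h - s' - h' * g \<in> A" using cover by blast
    have "g ^ r * s' \<in> mpv.span ((\<lambda>s. g ^ r * s) ` S)" using s'(1) by (rule span_mult_image)
    moreover have "mpv.span ((\<lambda>s. g ^ r * s) ` S) \<subseteq> mpv.span (?S (Suc r))"
      by (rule mpv.span_mono) auto
    moreover have "mpv.span (?S r) \<subseteq> mpv.span (?S (Suc r))"
      by (rule mpv.span_mono) auto
    ultimately have 1: "s + g ^ r * s' \<in> mpv.span (?S (Suc r))"
      using s(1) by (auto intro: mpv.span_add)
    have "f - (s + g ^ r * s') - h' * g ^ Suc r = (f - s - h * g ^ r) + g ^ r * (h - s' - h' * g)"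
      by (simp add: algebra_simps)
    also have "\<dots> \<in> A" using s(2) s'(2) by (auto intro: ideal_onD[OF A])
    finally show ?case using 1 by blast
  qed
  from this[of N] obtain s h where s: "s \<in> mpv.span (?S N)" "f - s - h * g ^ N \<in> A" by blast
  have "f - s = (f - s - h * g ^ N) + h * g ^ N" by simp
  also have "\<dots> \<in> A" by (intro ideal_onD(3)[OF A] s(2) ideal_onD(4)[OF A _ gN]) simp
  finally show ?thesis using s(1) by blast
qed

text \<open>The ideal generated by \<open>A\<close> and the list, set up so that the generators can be eliminated one by one.\<close>

fun add_generators :: "'r::comm_ring_1 set \<Rightarrow> 'r list \<Rightarrow> 'r set" where
  "add_generators A [] = A"
| "add_generators A (g # gs) = {a + h * g | a h. a \<in> add_generators A gs}"

lemma add_generators_ideal: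
  assumes "ideal_on UNIV A"
  shows "ideal_on UNIV (add_generators A gs)"
proof (induction gs)
  case (Cons g gs)
  note I = ideal_onD[OF Cons]
  show ?case
    unfolding ideal_on_def
  proof (intro conjI ballI)
    show "0 \<in> add_generators A (g # gs)"
      using I(2) by (auto intro!: exI[of _ 0])
  next
    fix a b assume "a \<in> add_generators A (g # gs)" "b \<in> add_generators A (g # gs)"
    then obtain a' h b' h' where *: "a = a' + h * g" "b = b' + h' * g"
      "a' \<in> add_generators A gs" "b' \<in> add_generators A gs" by auto
    have "a + b = (a' + b') + (h + h') * g" using * by (simp add: algebra_simps)
    then show "a + b \<in> add_generators A (g # gs)" using I(3)[OF *(3,4)] by auto
  next
    fix a r assume "a \<in> add_generators A (g # gs)"
    then obtain a' h where *: "a = a' + h * g" "a' \<in> add_generators A gs" by auto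
    have "r * a = r * a' + (r * h) * g" using * by (simp add: algebra_simps)
    then show "r * a \<in> add_generators A (g # gs)" using I(4)[OF _ *(2)] by auto
  qed auto
qed (use assms in simp)

lemma add_generators_contains:
  assumes "ideal_on UNIV A"
  shows "A \<subseteq> add_generators A gs" "set gs \<subseteq> add_generators A gs"
proof -
  have step: "add_generators A gs \<subseteq> add_generators A (g # gs)" for g gs
  proof
    fix x assume "x \<in> add_generators A gs"
    moreover have "x = x + 0 * g" by simp
    ultimately show "x \<in> add_generators A (g # gs)" unfolding add_generators.simps by blast
  qed
  show *: "A \<subseteq> add_generators A gs" for gs
  proof (induction gs)
    case (Cons g gs)
    then show ?case using step[of gs g] by (rule order_trans)
  qed simp
  show "set gs \<subseteq> add_generators A gs"
  proof (induction gs)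
    case (Cons g gs)
    have "0 \<in> add_generators A gs" by (rule ideal_onD(2)[OF add_generators_ideal[OF assms]])
    moreover have "g = 0 + 1 * g" by simp
    ultimately have "g \<in> add_generators A (g # gs)" unfolding add_generators.simps by blast
    then show ?case using Cons step[of gs g] by auto
  qed auto
qed

lemma span_mod_ideal_eliminate_generators:
  fixes gs :: "('v, 'a::field) mpoly list"
  assumes "ideal_on UNIV A" "\<And>g. g \<in> set gs \<Longrightarrow> g ^ N \<in> A" "finite S"
    and "\<And>f. \<exists>s\<in>mpv.span S. f - s \<in> add_generators A gs"
  shows "\<exists>S'. finite S' \<and> card S' \<le> N ^ length gs * card S \<and> (\<forall>f. \<exists>s\<in>mpv.span S'. f - s \<in> A)"
  using assms(2-)
proof (induction gs arbitrary: S)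
  case Nil
  then show ?case by (intro exI[of _ S]) auto
next
  case (Cons g gs)
  let ?S = "(\<lambda>(i, s). g ^ i * s) ` ({..<N} \<times> S)"
  have I: "ideal_on UNIV (add_generators A gs)"
    by (rule add_generators_ideal) fact
  have gN: "g ^ N \<in> add_generators A gs"
    using add_generators_contains(1)[OF assms(1)] Cons.prems(1) by auto
  have "\<exists>s\<in>mpv.span S. \<exists>h. f - s - h * g \<in> add_generators A gs" for f
  proof -
    obtain s where s: "s \<in> mpv.span S" "f - s \<in> add_generators A (g # gs)"
      using Cons.prems by blast
    then obtain a h where a: "f - s = a + h * g" "a \<in> add_generators A gs" by auto
    then have "f - s - h * g = a" by simp
    then show ?thesis using s a by metis
  qed
  note cover = span_mod_ideal_eliminate_generator[OF I gN this]
  have "finite ?S" using Cons.prems by auto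
  then obtain S' where S': "finite S'" "card S' \<le> N ^ length gs * card ?S"
    "\<forall>f. \<exists>s\<in>mpv.span S'. f - s \<in> A"
    using Cons.IH[of ?S] Cons.prems(1) cover by auto
  have "card ?S \<le> N * card S"
    using card_image_le[of "{..<N} \<times> S" "\<lambda>(i, s). g ^ i * s"] Cons.prems(2)
    by (simp add: card_cartesian_product)
  then have "N ^ length gs * card ?S \<le> N ^ length gs * (N * card S)"
    by (rule mult_left_mono) simp
  then have "card S' \<le> N ^ length (g # gs) * card S"
    using order_trans[OF S'(2)] by (simp only: length_Cons power_Suc mult_ac)
  then show ?case using S'(1,3) by blast
qed

abbreviation mdeg :: "('v \<Rightarrow>\<^sub>0 nat) \<Rightarrow> nat" where
  "mdeg \<equiv> weight (\<lambda>_. 0) 1"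

text \<open>The \<open>N\<close>-th power of the maximal ideal at the origin.\<close>

definition order_ge :: "nat \<Rightarrow> ('v, 'a::zero) mpoly set" where
  "order_ge N = {p. \<forall>m\<in>Poly_Mapping.keys p. N \<le> mdeg m}"

lemma order_ge_mult:
  fixes p q :: "('v, 'a::comm_ring_1) mpoly"
  assumes "p \<in> order_ge a" "q \<in> order_ge b"
  shows "p * q \<in> order_ge (a + b)"
  unfolding order_ge_def
proof safe
  fix m assume "m \<in> Poly_Mapping.keys (p * q)"
  then obtain k l where "m = k + l" "k \<in> Poly_Mapping.keys p" "l \<in> Poly_Mapping.keys q"
    using keys_mult[of p q] by blast
  then show "a + b \<le> mdeg m"
    using assms by (auto simp: order_ge_def weight_add intro: add_mono)
qed

lemma order_ge_power:
  fixes p :: "('v, 'a::comm_ring_1) mpoly"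
  assumes "p \<in> order_ge 1"
  shows "p ^ N \<in> order_ge N"
proof (induction N)
  case (Suc N)
  show ?case using order_ge_mult[OF assms Suc] by simp
qed (simp add: order_ge_def)

lemma order_ge_ideal: "ideal_on UNIV (order_ge N :: ('v, 'a::comm_ring_1) mpoly set)"
  unfolding ideal_on_def
proof (intro conjI ballI)
  fix a b :: "('v, 'a) mpoly"
  assume "a \<in> order_ge N" "b \<in> order_ge N"
  then show "a + b \<in> order_ge N" using keys_add[of a b] by (auto simp: order_ge_def)
next
  fix a b :: "('v, 'a) mpoly"
  assume "a \<in> order_ge N"
  then show "b * a \<in> order_ge N" using order_ge_mult[of b 0 a N] by (auto simp: order_ge_def)
qed (auto simp: order_ge_def)

lemma mdeg_eq_0: "mdeg m = 0 \<longleftrightarrow> m = 0"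
proof
  assume "mdeg m = 0"
  then have "\<forall>v\<in>Poly_Mapping.keys m. Poly_Mapping.lookup m v = 0"
    by (simp add: weight_def)
  then show "m = 0" by (intro poly_mapping_eqI) (metis in_keys_iff lookup_zero)
qed (simp add: weight_def)

lemma order_ge_1:
  assumes "Poly_Mapping.lookup p 0 = 0"
  shows "p \<in> order_ge 1"
  unfolding order_ge_def
proof safe
  fix m assume "m \<in> Poly_Mapping.keys p"
  then have "m \<noteq> 0" using assms by (metis in_keys_iff)
  then show "1 \<le> mdeg m" using mdeg_eq_0[of m] by linarith
qed

lemma weight_le_mdeg:
  fixes m :: "'v::finite \<Rightarrow>\<^sub>0 nat"
  assumes "\<And>v. idx v < n" "B > 0"
  shows "weight idx B m \<le> mdeg m * B ^ n"
proof -
  have "B ^ idx v \<le> B ^ n" for v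
    using assms by (intro power_increasing) (auto simp: less_imp_le Suc_le_eq)
  then have "weight idx B m \<le> (\<Sum>v\<in>Poly_Mapping.keys m. Poly_Mapping.lookup m v * B ^ n)"
    unfolding weight_def by (intro sum_mono mult_left_mono) auto
  then show ?thesis by (simp add: weight_def sum_distrib_right)
qed

lemma lookup_le_weight:
  assumes "B > 0"
  shows "Poly_Mapping.lookup m v \<le> weight idx B m"
proof (cases "v \<in> Poly_Mapping.keys m")
  case True
  have "Poly_Mapping.lookup m v \<le> Poly_Mapping.lookup m v * B ^ idx v" using assms by simp
  also have "\<dots> \<le> weight idx B m"
    unfolding weight_def by (rule member_le_sum) (use True in auto)
  finally show ?thesis .
qed (simp add: in_keys_iff)

definition monomial :: "('v \<Rightarrow>\<^sub>0 nat) \<Rightarrow> ('v, 'a::comm_ring_1) mpoly" where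
  "monomial m = Poly_Mapping.single m 1"

lemma single_eq_mscale_monomial: "Poly_Mapping.single m c = mscale c (monomial m)"
  by (rule poly_mapping_eqI) (simp add: monomial_def lookup_single when_def)

lemma monomial_add: "monomial (a + b) = monomial a * monomial b"
  by (simp add: monomial_def mult_single)

text \<open>Let \<open>l\<close> be the monomial of largest weight in \<open>D J\<close>.  Its variables lie in \<open>J\<close> and its exponents
  are below \<open>B\<close>, so it divides every monomial in which all variables of \<open>J\<close> have exponent at
  least \<open>B\<close>.  Subtracting a multiple of \<open>D J\<close> replaces such a monomial by monomials of smaller
  weight.\<close>

lemma monomials_mod_ideal:
  fixes I :: "('n::finite, 'a::field) mpoly set"
  assumes I: "ideal_on UNIV I"
    and D: "\<And>J. card J = d \<Longrightarrow> D J \<in> I \<and> D J \<noteq> 0 \<and> mpoly_vars (D J) \<subseteq> J"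
  obtains B :: nat and idx :: "'n \<Rightarrow> nat" where "B > 0" "\<And>v. idx v < CARD('n)"
    "\<And>a. \<exists>s\<in>mpv.span (monomial ` {b. card {v. B \<le> Poly_Mapping.lookup b v} < d
        \<and> weight idx B b \<le> weight idx B a}). monomial a - s \<in> I"
proof -
  obtain idx :: "'n \<Rightarrow> nat" where idx: "bij_betw idx UNIV {..<CARD('n)}"
    using ex_bij_betw_finite_nat[of "UNIV :: 'n set"] by (auto simp: atLeast0LessThan)
  have fin_keys: "finite (\<Union>J. Poly_Mapping.keys (D J))" by simp
  obtain B where B: "B > 0"
    and B_all: "\<forall>m\<in>(\<Union>J. Poly_Mapping.keys (D J)). \<forall>v. Poly_Mapping.lookup m v < B"
    using exponents_bounded[OF fin_keys] by blast
  have B_keys: "\<And>J m v. m \<in> Poly_Mapping.keys (D J) \<Longrightarrow> Poly_Mapping.lookup m v < B"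
    using B_all by blast
  let ?w = "weight idx B"
  let ?Std = "\<lambda>w. {b. card {v. B \<le> Poly_Mapping.lookup b v} < d \<and> ?w b \<le> w}"
  have red: "\<exists>s\<in>mpv.span (monomial ` ?Std (?w a)). monomial a - s \<in> I" for a
  proof (induction "?w a" arbitrary: a rule: less_induct)
    case less
    show ?case
    proof (cases "card {v. B \<le> Poly_Mapping.lookup a v} < d")
      case True
      then show ?thesis
        by (intro bexI[of _ "monomial a"]) (auto intro: mpv.span_base ideal_onD[OF I])
    next
      case False
      then obtain J where J: "J \<subseteq> {v. B \<le> Poly_Mapping.lookup a v}" "card J = d"
        using obtain_subset_with_card_n[of d "{v. B \<le> Poly_Mapping.lookup a v}"] by auto
      note DJ = D[OF J(2)]
      let ?K = "Poly_Mapping.keys (D J)"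
      have "?K \<noteq> {}" using DJ by simp
      then have "Max (?w ` ?K) \<in> ?w ` ?K" by (intro Max_in) auto
      then obtain l where l: "l \<in> ?K" and "Max (?w ` ?K) = ?w l" by auto
      then have l_max: "?w m \<le> ?w l" if "m \<in> ?K" for m
        using that Max_ge[of "?w ` ?K" "?w m"] by simp
      have lt: "?w m < ?w l" if "m \<in> ?K" "m \<noteq> l" for m
      proof -
        have "?w m \<noteq> ?w l"
          using weight_inj[OF idx, of m l B] B_keys that l by blast
        then show ?thesis using l_max[OF that(1)] by simp
      qed
      have l_le: "Poly_Mapping.lookup l v \<le> Poly_Mapping.lookup a v" for v
      proof (cases "v \<in> J")
        case True
        then show ?thesis using J B_keys[OF l, of v] by auto
      next
        case False
        then have "v \<notin> Poly_Mapping.keys l" using DJ l by (auto simp: mpoly_vars_def)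
        then show ?thesis by (simp add: in_keys_iff)
      qed
      define c where "c = a - l"
      have a: "a = c + l"
        by (rule poly_mapping_eqI) (simp add: c_def lookup_add lookup_minus l_le)
      define lc where "lc = Poly_Mapping.lookup (D J) l"
      have lc: "lc \<noteq> 0" using l by (simp add: lc_def in_keys_iff)
      have DJ_sum: "D J = mscale lc (monomial l)
          + (\<Sum>m\<in>?K - {l}. mscale (Poly_Mapping.lookup (D J) m) (monomial m))"
        using mpoly_sum_of_terms[of "D J"] l
        by (simp add: single_eq_mscale_monomial sum.remove lc_def)
      have "\<exists>s\<in>mpv.span (monomial ` ?Std (?w a)). monomial (c + m) - s \<in> I" if "m \<in> ?K - {l}" for m
      proof -
        have wl: "?w (c + m) < ?w a" using lt that by (simp add: a weight_add)
        obtain s where s: "s \<in> mpv.span (monomial ` ?Std (?w (c + m)))" "monomial (c + m) - s \<in> I"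
          using less[OF wl] by blast
        moreover have "mpv.span (monomial ` ?Std (?w (c + m))) \<subseteq> mpv.span (monomial ` ?Std (?w a))"
          using wl by (intro mpv.span_mono image_mono) auto
        ultimately show ?thesis by blast
      qed
      then have "\<forall>m\<in>?K - {l}. \<exists>s. s \<in> mpv.span (monomial ` ?Std (?w a)) \<and> monomial (c + m) - s \<in> I"
        by blast
      from bchoice[OF this] obtain s
        where "\<forall>m\<in>?K - {l}. s m \<in> mpv.span (monomial ` ?Std (?w a)) \<and> monomial (c + m) - s m \<in> I" ..
      then have s: "\<And>m. m \<in> ?K - {l} \<Longrightarrow> s m \<in> mpv.span (monomial ` ?Std (?w a))"
        "\<And>m. m \<in> ?K - {l} \<Longrightarrow> monomial (c + m) - s m \<in> I" by blast+
      define t where "t = mscale (- inverse lc)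
        (\<Sum>m\<in>?K - {l}. mscale (Poly_Mapping.lookup (D J) m) (s m))"
      have t: "t \<in> mpv.span (monomial ` ?Std (?w a))"
        unfolding t_def by (intro mpv.span_scale mpv.span_sum s)
      have "mscale lc (monomial a - t) = monomial c * D J
          - (\<Sum>m\<in>?K - {l}. mscale (Poly_Mapping.lookup (D J) m) (monomial (c + m) - s m))"
      proof -
        have "monomial c * mscale k (monomial m) = mscale k (monomial (c + m))" for k :: 'a and m
          by (simp add: mscale_def monomial_add mult_ac)
        then have "monomial c * D J = mscale lc (monomial a)
            + (\<Sum>m\<in>?K - {l}. mscale (Poly_Mapping.lookup (D J) m) (monomial (c + m)))"
          by (subst DJ_sum) (simp add: distrib_left sum_distrib_left a)
        moreover have "mscale lc t = - (\<Sum>m\<in>?K - {l}. mscale (Poly_Mapping.lookup (D J) m) (s m))"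
          using lc by (simp add: t_def mpv.scale_scale)
        ultimately show ?thesis
          by (simp add: mpv.scale_right_diff_distrib sum_subtractf)
      qed
      also have "\<dots> \<in> I"
        using DJ s(2) by (intro ideal_on_diff[OF I] ideal_on_sum[OF I])
          (auto simp: mscale_def intro: ideal_onD[OF I])
      finally have "mscale lc (monomial a - t) \<in> I" .
      then have "mscale (inverse lc) (mscale lc (monomial a - t)) \<in> I"
        unfolding mscale_def[of "inverse lc"] by (intro ideal_onD(4)[OF I]) auto
      then have "monomial a - t \<in> I" using lc by (simp add: mpv.scale_scale)
      then show ?thesis using t by blast
    qed
  qed
  show thesis
    by (rule that[OF B _ red]) (use idx in \<open>auto simp: bij_betw_def\<close>)
qed

text \<open>Monomials of degree below \<open>N\<close> are linearly independent modulo \<open>order_ge N\<close>: the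
  coefficients of their representatives in the span, taken at these monomials, form the identity
  matrix.\<close>

lemma card_le_span_mod_order:
  fixes E :: "('v \<Rightarrow>\<^sub>0 nat) set" and S :: "('v, 'a::field) mpoly set"
  assumes E: "\<And>m. m \<in> E \<Longrightarrow> mdeg m < N" "finite E"
    and S: "finite S" "\<And>f. \<exists>s\<in>mpv.span S. f - s \<in> order_ge N"
  shows "card E \<le> card S"
proof -
  obtain \<sigma> where \<sigma>: "\<And>f. \<sigma> f \<in> mpv.span S" "\<And>f. f - \<sigma> f \<in> order_ge N"
    using S(2) by metis
  define \<tau> where "\<tau> m = \<sigma> (monomial m)" for m
  have dual: "Poly_Mapping.lookup (\<tau> m) m' = (if m = m' then 1 else 0)" if "m' \<in> E" for m m'
  proof -
    have "m' \<notin> Poly_Mapping.keys (monomial m - \<tau> m)"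
      using \<sigma>(2)[of "monomial m"] E(1)[OF that] by (auto simp: order_ge_def \<tau>_def)
    then show ?thesis by (auto simp: in_keys_iff lookup_minus monomial_def lookup_single when_def)
  qed
  have inj: "inj_on \<tau> E"
    by (rule inj_onI) (metis dual zero_neq_one)
  have "mpv.independent (\<tau> ` E)"
  proof (rule mpv.independent_if_scalars_zero)
    show "finite (\<tau> ` E)" using E by simp
  next
    fix f x assume f: "(\<Sum>x\<in>\<tau> ` E. mscale (f x) x) = 0" and "x \<in> \<tau> ` E"
    then obtain m where m: "m \<in> E" "x = \<tau> m" by auto
    have "0 = Poly_Mapping.lookup (\<Sum>x\<in>\<tau> ` E. mscale (f x) x) m" using f by simp
    also have "\<dots> = (\<Sum>m'\<in>E. if m' = m then f (\<tau> m') else 0)"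
      by (simp add: sum.reindex[OF inj] lookup_sum dual m(1) if_distrib[of "\<lambda>t. _ * t"] cong: if_cong)
    also have "\<dots> = f x" using m E(2) by simp
    finally show "f x = 0" by simp
  qed
  moreover have "\<tau> ` E \<subseteq> mpv.span S" using \<sigma>(1) by (auto simp: \<tau>_def)
  ultimately have "card (\<tau> ` E) \<le> card S"
    using mpv.independent_span_bound[OF S(1)] by blast
  then show ?thesis by (simp add: card_image[OF inj])
qed

lemma card_exponents_box:
  fixes b :: "'n::finite \<Rightarrow> nat"
  shows "finite {m :: 'n \<Rightarrow>\<^sub>0 nat. \<forall>v. Poly_Mapping.lookup m v < b v}"
    "card {m :: 'n \<Rightarrow>\<^sub>0 nat. \<forall>v. Poly_Mapping.lookup m v < b v} = (\<Prod>v\<in>UNIV. b v)"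
proof -
  let ?E = "{m :: 'n \<Rightarrow>\<^sub>0 nat. \<forall>v. Poly_Mapping.lookup m v < b v}"
  have bij: "bij_betw Poly_Mapping.lookup ?E (PiE UNIV (\<lambda>v. {..<b v}))"
  proof (rule bij_betw_imageI)
    show "inj_on Poly_Mapping.lookup ?E"
      by (auto intro!: inj_onI poly_mapping_eqI)
    show "Poly_Mapping.lookup ` ?E = PiE UNIV (\<lambda>v. {..<b v})"
    proof safe
      fix f assume f: "f \<in> PiE UNIV (\<lambda>v. {..<b v})"
      have "Poly_Mapping.lookup (Abs_poly_mapping f) = f"
        by (rule Abs_poly_mapping_inverse) simp
      then show "f \<in> Poly_Mapping.lookup ` ?E"
        using f by (intro image_eqI[of _ _ "Abs_poly_mapping f"]) auto
    qed auto
  qed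
  have fin: "finite (PiE (UNIV :: 'n set) (\<lambda>v. {..<b v}))" by (simp add: finite_PiE)
  show "finite ?E" using bij fin by (simp add: bij_betw_finite)
  show "card ?E = (\<Prod>v\<in>UNIV. b v)"
    using bij_betw_same_card[OF bij] by (simp add: card_PiE)
qed

lemma card_exponents_few_large:
  assumes "B > 0" "d > 0"
  shows "finite {m :: 'n::finite \<Rightarrow>\<^sub>0 nat. card {v. B \<le> Poly_Mapping.lookup m v} < d
      \<and> (\<forall>v. Poly_Mapping.lookup m v \<le> L)}" (is "finite ?E")
    "card {m :: 'n::finite \<Rightarrow>\<^sub>0 nat. card {v. B \<le> Poly_Mapping.lookup m v} < d
      \<and> (\<forall>v. Poly_Mapping.lookup m v \<le> L)} \<le> 2 ^ CARD('n) * (B ^ CARD('n) * Suc L ^ (d - 1))"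
proof -
  let ?b = "\<lambda>K v. if v \<in> K then Suc L else B"
  let ?box = "\<lambda>K. {m :: 'n \<Rightarrow>\<^sub>0 nat. \<forall>v. Poly_Mapping.lookup m v < ?b K v}"
  let ?Ks = "{K :: 'n set. card K < d}"
  have sub: "?E \<subseteq> (\<Union>K\<in>?Ks. ?box K)"
  proof
    fix m assume "m \<in> ?E"
    then show "m \<in> (\<Union>K\<in>?Ks. ?box K)"
      by (intro UN_I[of "{v. B \<le> Poly_Mapping.lookup m v}"]) (auto simp: less_Suc_eq_le)
  qed
  have fin: "finite (\<Union>K\<in>?Ks. ?box K)"
    by (intro finite_UN_I card_exponents_box(1)) simp
  show "finite ?E" using finite_subset[OF sub fin] .
  have box: "card (?box K) \<le> B ^ CARD('n) * Suc L ^ (d - 1)" if "K \<in> ?Ks" for K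
  proof -
    have "card (?box K) = (\<Prod>v\<in>UNIV. ?b K v)" by (rule card_exponents_box(2))
    also have "\<dots> = Suc L ^ card K * B ^ card (- K)"
      by (subst prod.If_cases) (auto simp: Compl_eq)
    also have "\<dots> \<le> Suc L ^ (d - 1) * B ^ CARD('n)"
      using that assms by (intro mult_mono power_increasing) (auto intro: card_mono)
    finally show ?thesis by (simp add: mult.commute)
  qed
  have "card ?E \<le> card (\<Union>K\<in>?Ks. ?box K)" by (rule card_mono[OF fin sub])
  also have "\<dots> \<le> (\<Sum>K\<in>?Ks. card (?box K))" by (rule card_UN_le) simp
  also have "\<dots> \<le> (\<Sum>K\<in>?Ks. B ^ CARD('n) * Suc L ^ (d - 1))" by (rule sum_mono) (rule box)
  also have "\<dots> = card ?Ks * (B ^ CARD('n) * Suc L ^ (d - 1))" by simp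
  also have "\<dots> \<le> 2 ^ CARD('n) * (B ^ CARD('n) * Suc L ^ (d - 1))"
    using card_mono[of "UNIV :: 'n set set" ?Ks]
    by (intro mult_right_mono) (auto simp: card_Pow simp flip: Pow_UNIV)
  finally show "card ?E \<le> 2 ^ CARD('n) * (B ^ CARD('n) * Suc L ^ (d - 1))" .
qed

text \<open>If every choice of \<open>d\<close> coordinates had a relation, the \<open>M ^ n\<close> monomials with exponents below \<open>M\<close>
  would lie in the span of \<open>C * M ^ (n - 1)\<close> polynomials modulo \<open>order_ge N\<close>, with \<open>C\<close> independent
  of \<open>M\<close>.  For this comparison \<open>N = n * M\<close> exceeds the degrees of all these monomials.\<close>

theorem independent_coordinates_exist:
  fixes gs :: "('n::finite, 'a::field) mpoly list"
  assumes len: "length gs < CARD('n)" and gs: "\<And>g. g \<in> set gs \<Longrightarrow> Poly_Mapping.lookup g 0 = 0"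
  shows "\<exists>J :: 'n set. card J = CARD('n) - length gs \<and>
    (\<forall>D\<in>gen_ideal gs. mpoly_vars D \<subseteq> J \<longrightarrow> D = 0)"
proof (rule ccontr)
  define n k d where "n = CARD('n)" and "k = length gs" and "d = n - k"
  assume "\<not> ?thesis"
  then have "\<forall>J :: 'n set. card J = d \<longrightarrow> (\<exists>D. D \<in> gen_ideal gs \<and> D \<noteq> 0 \<and> mpoly_vars D \<subseteq> J)"
    by (auto simp: d_def n_def k_def)
  then obtain D where D: "\<And>J :: 'n set. card J = d \<Longrightarrow>
      D J \<in> gen_ideal gs \<and> D J \<noteq> 0 \<and> mpoly_vars (D J) \<subseteq> J" by metis
  have d: "d > 0" "k + (d - 1) = n - 1" "n > 0" using len by (auto simp: d_def n_def k_def)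
  obtain B :: nat and idx :: "'n \<Rightarrow> nat" where B: "B > 0" and idx: "\<And>v. idx v < n"
    and red: "\<And>a. \<exists>s\<in>mpv.span (monomial ` {b. card {v. B \<le> Poly_Mapping.lookup b v} < d
        \<and> weight idx B b \<le> weight idx B a}). monomial a - s \<in> gen_ideal gs"
    using monomials_mod_ideal[OF ideal_on_gen_ideal D] unfolding n_def by blast
  have bound: "M ^ n \<le> (n * M) ^ k * (2 ^ n * (B ^ n * Suc (n * M * B ^ n) ^ (d - 1)))"
    if M: "M > 0" for M
  proof -
    define N where "N = n * M"
    \<comment> \<open>bounds the weights, hence the exponents, that arise from monomials of degree below \<open>N\<close>\<close>
    define L where "L = N * B ^ n"
    define Std where "Std = {m :: 'n \<Rightarrow>\<^sub>0 nat. card {v. B \<le> Poly_Mapping.lookup m v} < d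
        \<and> (\<forall>v. Poly_Mapping.lookup m v \<le> L)}"
    have fin: "finite Std" and card_Std: "card Std \<le> 2 ^ n * (B ^ n * Suc L ^ (d - 1))"
      unfolding Std_def n_def using card_exponents_few_large[OF B d(1)] by blast+
    let ?S = "monomial ` Std :: ('n, 'a) mpoly set"
    let ?A = "order_ge N :: ('n, 'a) mpoly set"
    have A: "ideal_on UNIV ?A" by (rule order_ge_ideal)
    have I: "ideal_on UNIV (add_generators ?A gs)" by (rule add_generators_ideal[OF A])
    have gsA: "gen_ideal gs \<subseteq> add_generators ?A gs"
      by (rule gen_ideal_subset[OF I add_generators_contains(2)[OF A]])
    have monomial_cover: "\<exists>s\<in>mpv.span ?S. monomial a - s \<in> add_generators ?A gs" for a
    proof (cases "mdeg a < N")
      case True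
      obtain s where s: "s \<in> mpv.span (monomial ` {b. card {v. B \<le> Poly_Mapping.lookup b v} < d
          \<and> weight idx B b \<le> weight idx B a})" "monomial a - s \<in> gen_ideal gs"
        using red by blast
      have "weight idx B a \<le> L"
        using weight_le_mdeg[OF idx B, where m = a] True unfolding L_def
        by (meson less_imp_le mult_le_mono1 order_trans)
      then have "Poly_Mapping.lookup b v \<le> L" if "weight idx B b \<le> weight idx B a" for b v
        using lookup_le_weight[OF B, of b v idx] that by linarith
      then have "mpv.span (monomial ` {b. card {v. B \<le> Poly_Mapping.lookup b v} < d
          \<and> weight idx B b \<le> weight idx B a}) \<subseteq> mpv.span ?S"
        by (intro mpv.span_mono image_mono) (auto simp: Std_def)
      then show ?thesis using s gsA by blast
    next
      case False
      then have "monomial a \<in> ?A" by (auto simp: order_ge_def monomial_def split: if_splits)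
      then show ?thesis
        using add_generators_contains(1)[OF A, of gs] by (intro bexI[of _ 0]) (auto simp: mpv.span_zero)
    qed
    have cover: "\<exists>s\<in>mpv.span ?S. f - s \<in> add_generators ?A gs" for f
    proof (induction f rule: mpoly_induct)
      case zero
      show ?case using ideal_onD(2)[OF I] by (intro bexI[of _ 0]) (auto simp: mpv.span_zero)
    next
      case (single m c)
      obtain s where s: "s \<in> mpv.span ?S" "monomial m - s \<in> add_generators ?A gs"
        using monomial_cover by blast
      have "Poly_Mapping.single m c - mscale c s = mpoly_const c * (monomial m - s)"
        by (simp add: single_eq_mscale_monomial mscale_def algebra_simps)
      then show ?case
        using s by (intro bexI[of _ "mscale c s"]) (auto intro: ideal_onD[OF I] mpv.span_scale)
    next
      case (add p q)
      then obtain s t where "s \<in> mpv.span ?S" "p - s \<in> add_generators ?A gs"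
        "t \<in> mpv.span ?S" "q - t \<in> add_generators ?A gs" by blast
      moreover have "p + q - (s + t) = (p - s) + (q - t)" by simp
      ultimately show ?case
        by (intro bexI[of _ "s + t"]) (simp_all only: ideal_onD[OF I] mpv.span_add)
    qed
    obtain S' where S': "finite S'" "card S' \<le> N ^ k * card ?S"
      "\<And>f. \<exists>s\<in>mpv.span S'. f - s \<in> ?A"
      using span_mod_ideal_eliminate_generators[OF A _ _ cover] fin gs order_ge_1 order_ge_power
      unfolding k_def by (metis finite_imageI)
    let ?E = "{m :: 'n \<Rightarrow>\<^sub>0 nat. \<forall>v. Poly_Mapping.lookup m v < M}"
    have deg_E: "mdeg m < N" if "m \<in> ?E" for m
    proof -
      have "mdeg m = (\<Sum>v\<in>UNIV. Poly_Mapping.lookup m v)"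
        by (subst weight_superset[of UNIV]) auto
      also have "\<dots> < (\<Sum>v\<in>(UNIV :: 'n set). M)"
        by (rule sum_strict_mono) (use that in auto)
      finally show ?thesis by (simp add: N_def n_def)
    qed
    have "M ^ n = card ?E" using card_exponents_box(2)[of "\<lambda>_ :: 'n. M"] by (simp add: n_def)
    also have "\<dots> \<le> card S'"
      using card_le_span_mod_order[of ?E N S'] deg_E S' card_exponents_box(1)[of "\<lambda>_ :: 'n. M"] by blast
    also have "\<dots> \<le> N ^ k * card ?S" by (rule S')
    also have "\<dots> \<le> N ^ k * card Std"
      using card_image_le[OF fin] by (intro mult_left_mono) auto
    also have "\<dots> \<le> N ^ k * (2 ^ n * (B ^ n * Suc L ^ (d - 1)))"
      using card_Std by (intro mult_left_mono) auto
    finally show ?thesis by (simp only: N_def L_def)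
  qed
  define C where "C = n ^ k * (2 ^ n * (B ^ n * (2 * n * B ^ n) ^ (d - 1)))"
  define M where "M = Suc C"
  have M: "M > 0" by (simp add: M_def)
  have "Suc (n * M * B ^ n) \<le> 2 * n * B ^ n * M"
    using M B d(3) by (simp add: Suc_le_eq)
  then have "Suc (n * M * B ^ n) ^ (d - 1) \<le> (2 * n * B ^ n * M) ^ (d - 1)"
    by (rule power_mono) simp
  then have "(n * M) ^ k * (2 ^ n * (B ^ n * Suc (n * M * B ^ n) ^ (d - 1)))
      \<le> (n * M) ^ k * (2 ^ n * (B ^ n * (2 * n * B ^ n * M) ^ (d - 1)))"
    by (intro mult_left_mono) auto
  also have "\<dots> = C * M ^ (k + (d - 1))"
    by (simp add: C_def power_mult_distrib power_add mult_ac)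
  also have "\<dots> < M * M ^ (n - 1)" unfolding d(2) using M by (simp add: M_def)
  also have "\<dots> = M ^ n" using d(3) by (metis Suc_diff_1 power_Suc)
  finally show False using bound[OF M] by simp
qed

section \<open>General points of a projection\<close>

definition is_subring :: "'r::comm_ring_1 set \<Rightarrow> bool" where
  "is_subring R \<longleftrightarrow> 1 \<in> R \<and> -1 \<in> R \<and> (\<forall>a\<in>R. \<forall>b\<in>R. a + b \<in> R) \<and> (\<forall>a\<in>R. \<forall>b\<in>R. a * b \<in> R)"

lemma is_subringD:
  assumes "is_subring R"
  shows "1 \<in> R" "-1 \<in> R" "0 \<in> R" "a \<in> R \<Longrightarrow> b \<in> R \<Longrightarrow> a + b \<in> R"
    "a \<in> R \<Longrightarrow> b \<in> R \<Longrightarrow> a * b \<in> R" "a \<in> R \<Longrightarrow> a ^ k \<in> R"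
proof -
  show *: "1 \<in> R" "-1 \<in> R" "a \<in> R \<Longrightarrow> b \<in> R \<Longrightarrow> a + b \<in> R"
    "a \<in> R \<Longrightarrow> b \<in> R \<Longrightarrow> a * b \<in> R" for a b using assms by (auto simp: is_subring_def)
  show "0 \<in> R" using *(3)[OF *(1,2)] by simp
  show "a \<in> R \<Longrightarrow> a ^ k \<in> R" by (induction k) (auto intro: *)
qed

lemma is_subring_ideal: "is_subring R \<Longrightarrow> ideal_on R R"
  by (auto simp: ideal_on_def is_subringD)

definition prime_on :: "'r::comm_ring_1 set \<Rightarrow> 'r set \<Rightarrow> bool" where
  "prime_on R Q \<longleftrightarrow> ideal_on R Q \<and> 1 \<notin> Q \<and> (\<forall>a\<in>R. \<forall>b\<in>R. a * b \<in> Q \<longrightarrow> a \<in> Q \<or> b \<in> Q)"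

lemma prime_onD:
  assumes "prime_on R Q"
  shows "ideal_on R Q" "1 \<notin> Q" "a \<in> R \<Longrightarrow> b \<in> R \<Longrightarrow> a * b \<in> Q \<Longrightarrow> a \<in> Q \<or> b \<in> Q"
  using assms by (auto simp: prime_on_def)

lemma prime_on_power:
  assumes "prime_on R Q" "is_subring R" "a \<in> R" "a ^ k \<in> Q"
  shows "a \<in> Q"
  using assms(4)
proof (induction k)
  case (Suc k)
  then show ?case
    using prime_onD(3)[OF assms(1,3) is_subringD(6)[OF assms(2,3)]] by auto
qed (use prime_onD(2)[OF assms(1)] in auto)

lemma ideal_on_adjoin:
  assumes R: "is_subring R" and Q: "ideal_on R Q" and v: "v \<in> R"
  shows "ideal_on R {q + h * v | q h. q \<in> Q \<and> h \<in> R}" (is "ideal_on R ?T")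
  unfolding ideal_on_def
proof (intro conjI ballI)
  show "?T \<subseteq> R" using ideal_onD(1)[OF Q] v by (auto intro!: is_subringD[OF R])
  have "0 = 0 + 0 * v" by simp
  then show "0 \<in> ?T" using ideal_onD(2)[OF Q] is_subringD(3)[OF R] by blast
next
  fix a b assume "a \<in> ?T" "b \<in> ?T"
  then obtain q h q' h' where *: "q \<in> Q" "h \<in> R" "q' \<in> Q" "h' \<in> R" "a = q + h * v" "b = q' + h' * v"
    by auto
  have "a + b = (q + q') + (h + h') * v" using * by (simp add: algebra_simps)
  then show "a + b \<in> ?T" using * ideal_onD(3)[OF Q] is_subringD(4)[OF R] by blast
next
  fix r a assume "r \<in> R" "a \<in> ?T"
  then obtain q h where *: "q \<in> Q" "h \<in> R" "a = q + h * v" by auto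
  have "r * a = r * q + (r * h) * v" using * by (simp add: algebra_simps)
  then show "r * a \<in> ?T" using * \<open>r \<in> R\<close> ideal_onD(4)[OF Q] is_subringD(5)[OF R] by blast
qed

text \<open>By Zorn's lemma some ideal is maximal among those that contain \<open>E\<close> and avoid \<open>M\<close>.  Adjoining an
  element from outside produces an element of \<open>M\<close>.  For two such elements whose product is in the
  ideal, the product of the resulting elements of \<open>M\<close> would be in the ideal as well.\<close>

lemma prime_ideal_avoiding:
  assumes R: "is_subring R" and E: "ideal_on R E"
    and M: "1 \<in> M" "\<And>a b. a \<in> M \<Longrightarrow> b \<in> M \<Longrightarrow> a * b \<in> M" and EM: "E \<inter> M = {}"
  shows "\<exists>Q. prime_on R Q \<and> E \<subseteq> Q \<and> Q \<inter> M = {}"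
proof -
  let ?A = "{T. ideal_on R T \<and> E \<subseteq> T \<and> T \<inter> M = {}}"
  have "\<exists>Q\<in>?A. \<forall>X\<in>?A. Q \<subseteq> X \<longrightarrow> X = Q"
  proof (rule subset_Zorn_nonempty)
    show "?A \<noteq> {}" using E EM by blast
  next
    fix C assume C: "C \<noteq> {}" "subset.chain ?A C"
    have mem: "T \<in> C \<Longrightarrow> ideal_on R T \<and> E \<subseteq> T \<and> T \<inter> M = {}" for T
      using C(2) by (auto simp: subset.chain_def)
    have "ideal_on R (\<Union>C)"
      unfolding ideal_on_def
    proof (intro conjI ballI)
      show "\<Union>C \<subseteq> R" using mem ideal_onD(1) by blast
      show "0 \<in> \<Union>C" using mem C(1) ideal_onD(2) by blast
    next
      fix a b assume "a \<in> \<Union>C" "b \<in> \<Union>C"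
      then obtain S T where ST: "S \<in> C" "a \<in> S" "T \<in> C" "b \<in> T" by blast
      have "S \<subseteq> T \<or> T \<subseteq> S" using C(2) ST by (auto simp: subset_chain_def)
      then show "a + b \<in> \<Union>C" using ST mem ideal_onD(3) by (metis UnionI subsetD)
    next
      fix r a assume "r \<in> R" "a \<in> \<Union>C"
      then show "r * a \<in> \<Union>C" using mem ideal_onD(4) by blast
    qed
    then show "\<Union>C \<in> ?A" using mem C(1) by blast
  qed
  then obtain Q where QA: "Q \<in> ?A" and Q_top: "\<forall>X\<in>?A. Q \<subseteq> X \<longrightarrow> X = Q"
    by (rule bexE)
  from QA have Q: "ideal_on R Q" "E \<subseteq> Q" "Q \<inter> M = {}" by simp_all
  have Q_max: "X = Q" if "ideal_on R X" "E \<subseteq> X" "X \<inter> M = {}" "Q \<subseteq> X" for X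
    using Q_top that by simp
  have meets: "\<exists>q\<in>Q. \<exists>h\<in>R. q + h * a \<in> M" if a: "a \<in> R" "a \<notin> Q" for a
  proof (rule ccontr)
    assume no: "\<not> ?thesis"
    let ?T = "{q + h * a | q h. q \<in> Q \<and> h \<in> R}"
    have sub: "Q \<subseteq> ?T"
    proof
      fix q assume "q \<in> Q"
      moreover have "q = q + 0 * a" by simp
      ultimately show "q \<in> ?T" using is_subringD(3)[OF R] by blast
    qed
    have "a = 0 + 1 * a" by simp
    then have "a \<in> ?T" using ideal_onD(2)[OF Q(1)] is_subringD(1)[OF R] by blast
    moreover have "?T = Q"
      by (rule Q_max) (use ideal_on_adjoin[OF R Q(1) a(1)] sub Q(2) no in auto)
    ultimately show False using a(2) by simp
  qed
  have "prime_on R Q"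
    unfolding prime_on_def
  proof (intro conjI ballI impI)
    show "ideal_on R Q" by (rule Q)
    show "1 \<notin> Q" using Q(3) M(1) by blast
  next
    fix a b assume ab: "a \<in> R" "b \<in> R" "a * b \<in> Q"
    show "a \<in> Q \<or> b \<in> Q"
    proof (rule ccontr)
      assume "\<not> (a \<in> Q \<or> b \<in> Q)"
      then obtain q h q' h' where *: "q \<in> Q" "h \<in> R" "q + h * a \<in> M" "q' \<in> Q" "h' \<in> R" "q' + h' * b \<in> M"
        using meets ab by metis
      have QR: "Q \<subseteq> R" by (rule ideal_onD(1)[OF Q(1)])
      have in_R: "q' + h' * b \<in> R" "h * a \<in> R" "h * h' \<in> R"
        using * ab QR by (auto intro!: is_subringD(4,5)[OF R])
      have "(q + h * a) * (q' + h' * b) = (q' + h' * b) * q + ((h * a) * q' + (h * h') * (a * b))"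
        by (simp add: algebra_simps)
      also have "\<dots> \<in> Q"
        by (rule ideal_onD(3)[OF Q(1) ideal_onD(4)[OF Q(1) in_R(1) *(1)]
              ideal_onD(3)[OF Q(1) ideal_onD(4)[OF Q(1) in_R(2) *(4)] ideal_onD(4)[OF Q(1) in_R(3) ab(3)]]])
      finally show False using M(2)[OF *(3,6)] Q(3) by blast
    qed
  qed
  then show ?thesis using Q by blast
qed

definition coeffs_in :: "'r::comm_ring_1 set \<Rightarrow> 'r poly set" where
  "coeffs_in B = {F. \<forall>k. coeff F k \<in> B}"

lemma coeffs_in_closed:
  assumes "ideal_on R Q" "-1 \<in> R"
  shows "F \<in> coeffs_in Q \<Longrightarrow> G \<in> coeffs_in Q \<Longrightarrow> F + G \<in> coeffs_in Q"
    "F \<in> coeffs_in Q \<Longrightarrow> G \<in> coeffs_in Q \<Longrightarrow> F - G \<in> coeffs_in Q"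
    "F \<in> coeffs_in R \<Longrightarrow> G \<in> coeffs_in Q \<Longrightarrow> F * G \<in> coeffs_in Q"
    "c \<in> R \<Longrightarrow> G \<in> coeffs_in Q \<Longrightarrow> smult c G \<in> coeffs_in Q"
    "c \<in> Q \<Longrightarrow> monom c k \<in> coeffs_in Q"
    "0 \<in> coeffs_in Q"
  using ideal_onD[OF assms(1)] ideal_on_diff[OF assms]
  by (auto simp: coeffs_in_def coeff_mult intro!: ideal_on_sum[OF assms(1)])

lemma pseudo_division:
  assumes B: "is_subring B" and F: "F \<in> coeffs_in B" "degree F > 0" and G: "G \<in> coeffs_in B"
  shows "\<exists>s q r. q \<in> coeffs_in B \<and> r \<in> coeffs_in B \<and> smult (lead_coeff F ^ s) G = q * F + r
    \<and> degree r < degree F \<and> degree q \<le> degree G - degree F"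
  using G
proof (induction "degree G" arbitrary: G rule: less_induct)
  case less
  note cl = coeffs_in_closed[OF is_subring_ideal[OF B] is_subringD(2)[OF B]]
  let ?a = "lead_coeff F"
  show ?case
  proof (cases "degree G < degree F")
    case True
    then show ?thesis
      using cl(6) less.prems by (intro exI[of _ 0] exI[of _ G]) auto
  next
    case False
    let ?k = "degree G - degree F"
    let ?m = "monom (lead_coeff G) ?k"
    have in_B: "?a \<in> B" "lead_coeff G \<in> B" using F less.prems by (auto simp: coeffs_in_def)
    define G' where "G' = smult ?a G - ?m * F"
    have G'_B: "G' \<in> coeffs_in B"
      unfolding G'_def by (intro cl in_B less.prems F)
    have "degree (?m * F) \<le> degree G"
      using degree_mult_le[of ?m F] degree_monom_le[of "lead_coeff G" ?k] False by linarith
    then have "degree G' \<le> degree G"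
      unfolding G'_def by (intro degree_diff_le degree_smult_le)
    moreover have "coeff (?m * F) (degree G) = lead_coeff G * ?a"
      using False by (simp add: coeff_monom_mult)
    then have "coeff G' (degree G) = 0"
      by (simp add: G'_def mult.commute)
    ultimately have deg: "degree G' < degree G"
      using False F(2) by (metis degree_0 le_neq_implies_less leading_coeff_0_iff linorder_not_less)
    obtain s q r where IH: "q \<in> coeffs_in B" "r \<in> coeffs_in B"
      "smult (?a ^ s) G' = q * F + r" "degree r < degree F" "degree q \<le> degree G' - degree F"
      using less.hyps[OF deg G'_B] by blast
    define q' where "q' = q + smult (?a ^ s) ?m"
    have "smult (?a ^ Suc s) G = smult (?a ^ s) (G' + ?m * F)"
      by (simp add: G'_def mult.commute)
    also have "\<dots> = q' * F + r"
      by (simp add: smult_add_right IH(3) q'_def algebra_simps)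
    finally have "smult (?a ^ Suc s) G = q' * F + r" .
    moreover have "q' \<in> coeffs_in B"
      unfolding q'_def by (intro cl IH in_B is_subringD(6)[OF B])
    moreover have "degree q' \<le> ?k"
      unfolding q'_def using IH(5) deg degree_smult_le[of "?a ^ s" ?m] degree_monom_le[of "lead_coeff G" ?k]
      by (intro degree_add_le) linarith+
    ultimately show ?thesis using IH(2,4) by blast
  qed
qed

text \<open>Leading coefficients that lie in \<open>Q\<close> are harmless but spoil degree arguments.  Cutting them off
  turns the degree of a polynomial into its degree over \<open>B / Q\<close>, so that remainders of a
  pseudo-division by an element of least degree have all their coefficients in \<open>Q\<close>.\<close>

lemma least_degree_element:
  assumes T: "ideal_on R T" "Q \<subseteq> T" and Q: "ideal_on R Q" and R: "is_subring R" "\<tau> \<in> R"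
    and B: "is_subring B" "B \<subseteq> R"
    and ex: "F0 \<in> coeffs_in B" "poly F0 \<tau> \<in> T" "F0 \<notin> coeffs_in Q"
  obtains F where "F \<in> coeffs_in B" "poly F \<tau> \<in> T" "lead_coeff F \<notin> Q"
    "\<And>G. G \<in> coeffs_in B \<Longrightarrow> poly G \<tau> \<in> T \<Longrightarrow> degree G < degree F \<Longrightarrow> G \<in> coeffs_in Q"
proof -
  let ?P = "\<lambda>F. F \<in> coeffs_in B \<and> poly F \<tau> \<in> T \<and> lead_coeff F \<notin> Q"
  have strip: "\<exists>G. ?P G \<and> degree G \<le> degree F"
    if F: "F \<in> coeffs_in B" "poly F \<tau> \<in> T" "F \<notin> coeffs_in Q" for F
  proof -
    let ?K = "{k. coeff F k \<notin> Q}"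
    have "?K \<subseteq> {..degree F}"
      using ideal_onD(2)[OF Q] by (auto intro: le_degree)
    then have fin: "finite ?K" by (rule finite_subset) simp
    have ne: "?K \<noteq> {}" using F(3) by (auto simp: coeffs_in_def)
    define n where "n = Max ?K"
    have n: "coeff F n \<notin> Q" unfolding n_def using Max_in[OF fin ne] by blast
    have n_max: "coeff F k \<in> Q" if "k > n" for k using Max_ge[OF fin, of k] that unfolding n_def by (meson linorder_not_less mem_Collect_eq)
    define G where "G = poly_cutoff (Suc n) F"
    have coeff_G: "coeff G k = (if k \<le> n then coeff F k else 0)" for k
      by (simp add: G_def coeff_poly_cutoff less_Suc_eq_le)
    have deg: "degree G = n"
      using n ideal_onD(2)[OF Q]
      by (intro antisym degree_le le_degree) (auto simp: coeff_G)
    have "F - G \<in> coeffs_in Q"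
      unfolding coeffs_in_def
    proof safe
      fix k show "coeff (F - G) k \<in> Q"
        using n_max[of k] ideal_onD(2)[OF Q] by (cases "k \<le> n") (simp_all add: coeff_G)
    qed
    then have "poly (F - G) \<tau> \<in> Q"
      unfolding poly_altdef coeffs_in_def
      by (intro ideal_on_sum[OF Q]) (auto simp: mult.commute[of _ "\<tau> ^ _"] intro!: ideal_onD(4)[OF Q] is_subringD(6)[OF R])
    then have "poly F \<tau> - poly (F - G) \<tau> \<in> T"
      using F(2) T(2) by (intro ideal_on_diff[OF T(1) is_subringD(2)[OF R(1)]]) auto
    moreover have "G \<in> coeffs_in B"
      using F(1) is_subringD(3)[OF B(1)] by (auto simp: coeffs_in_def coeff_G)
    moreover have "n \<le> degree F" using n ideal_onD(2)[OF Q] by (intro le_degree) auto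
    ultimately show ?thesis using n by (intro exI[of _ G]) (auto simp: deg coeff_G)
  qed
  obtain F1 where "?P F1" using strip[OF ex] by blast
  from ex_has_least_nat[of ?P, OF this, of degree]
  obtain F where F: "?P F" "\<And>F'. ?P F' \<Longrightarrow> degree F \<le> degree F'" by blast
  show thesis
    by (rule that[of F]) (use F strip in \<open>blast, blast, blast, meson leD le_less_trans\<close>)
qed

text \<open>
  Modulo the prime ideal \<open>Q\<close> of \<open>R = B[\<tau>]\<close>, the element \<open>\<tau>\<close> is transcendental or algebraic over
  \<open>B\<close>.  In the algebraic case \<open>F\<close> is a polynomial of least degree for \<open>\<tau>\<close>, and some multiple of \<open>v\<close>
  lies in \<open>B\<close> modulo \<open>Q\<close> without being in \<open>Q\<close>.  To find it, take \<open>G\<close> of least degree in the ideal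
  generated by \<open>Q\<close> and \<open>v\<close>.  If \<open>G\<close> had positive degree, it would divide both \<open>F\<close> and \<open>V\<close> up to
  factors from \<open>B\<close>; minimality of \<open>F\<close> would make \<open>G\<close> vanish at \<open>\<tau>\<close>, and then \<open>v\<close> as well.
\<close>

lemma prime_simple_extension:
  fixes \<tau> :: "'r::comm_ring_1"
  assumes B: "is_subring B" and R_def: "R = (\<lambda>F. poly F \<tau>) ` coeffs_in B" and R: "is_subring R"
    and Q: "prime_on R Q" and V: "V \<in> coeffs_in B" "poly V \<tau> \<notin> Q"
  obtains (transcendental) "\<And>G. G \<in> coeffs_in B \<Longrightarrow> poly G \<tau> \<in> Q \<Longrightarrow> G \<in> coeffs_in Q"
      "V \<notin> coeffs_in Q"
  | (algebraic) F b H where "F \<in> coeffs_in B" "degree F > 0" "lead_coeff F \<notin> Q"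
      "\<And>G. G \<in> coeffs_in B \<Longrightarrow> poly G \<tau> \<in> Q \<Longrightarrow> \<exists>s q r. q \<in> coeffs_in B \<and> r \<in> coeffs_in B \<and>
        r \<in> coeffs_in Q \<and> smult (lead_coeff F ^ s) G = q * F + r"
      "b \<in> B" "b \<notin> Q" "H \<in> coeffs_in B" "b - poly H \<tau> * poly V \<tau> \<in> Q"
proof -
  note clB = coeffs_in_closed[OF is_subring_ideal[OF B] is_subringD(2)[OF B]]
  note I = prime_onD(1)[OF Q]
  have m1: "-1 \<in> R" by (rule is_subringD(2)[OF R])
  have BR: "B \<subseteq> R"
  proof
    fix c assume "c \<in> B"
    then have "monom c 0 \<in> coeffs_in B" by (rule clB)
    then show "c \<in> R" unfolding R_def by (intro image_eqI[of _ _ "monom c 0"]) (auto simp: poly_monom)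
  qed
  have \<tau>: "\<tau> \<in> R"
    unfolding R_def
    by (rule image_eqI[of _ _ "monom 1 1"]) (auto simp: poly_monom intro!: clB is_subringD[OF B])
  have evR: "poly F \<tau> \<in> R" if "F \<in> coeffs_in B" for F using that by (auto simp: R_def)
  have clQ: "F * G \<in> coeffs_in Q" if "F \<in> coeffs_in B" "G \<in> coeffs_in Q" for F G
    by (rule coeffs_in_closed(3)[OF I m1]) (use that BR in \<open>auto simp: coeffs_in_def\<close>)
  have evQ: "poly F \<tau> \<in> Q" if "F \<in> coeffs_in Q" for F
    using that unfolding poly_altdef coeffs_in_def
    by (intro ideal_on_sum[OF I])
      (auto simp: mult.commute[of _ "\<tau> ^ _"] intro!: ideal_onD(4)[OF I] is_subringD(6)[OF R] \<tau>)
  let ?v = "poly V \<tau>"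
  have vR: "?v \<in> R" by (rule evR[OF V(1)])
  show thesis
  proof (cases "\<forall>G\<in>coeffs_in B. poly G \<tau> \<in> Q \<longrightarrow> G \<in> coeffs_in Q")
    case True
    then show thesis using transcendental evQ V(2) by blast
  next
    case False
    then obtain F0 where F0: "F0 \<in> coeffs_in B" "poly F0 \<tau> \<in> Q" "F0 \<notin> coeffs_in Q" by blast
    obtain F where F: "F \<in> coeffs_in B" "poly F \<tau> \<in> Q" "lead_coeff F \<notin> Q"
      and F_least: "\<And>G. G \<in> coeffs_in B \<Longrightarrow> poly G \<tau> \<in> Q \<Longrightarrow> degree G < degree F \<Longrightarrow> G \<in> coeffs_in Q"
      using least_degree_element[OF I order_refl I R \<tau> B BR F0] by metis
    have degF: "degree F > 0"
    proof (rule ccontr)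
      assume "\<not> degree F > 0"
      then obtain c where "F = [:c:]" by (auto elim: degree_eq_zeroE)
      then show False using F(2,3) by simp
    qed
    have divF: "\<exists>s q r. q \<in> coeffs_in B \<and> r \<in> coeffs_in B \<and> r \<in> coeffs_in Q \<and>
        smult (lead_coeff F ^ s) G = q * F + r"
      if G: "G \<in> coeffs_in B" "poly G \<tau> \<in> Q" for G
    proof -
      obtain s q r where *: "q \<in> coeffs_in B" "r \<in> coeffs_in B"
        "smult (lead_coeff F ^ s) G = q * F + r" "degree r < degree F"
        using pseudo_division[OF B F(1) degF G(1)] by blast
      have "r = smult (lead_coeff F ^ s) G - q * F" using *(3) by simp
      then have "poly r \<tau> = lead_coeff F ^ s * poly G \<tau> - poly q \<tau> * poly F \<tau>" by simp
      also have "\<dots> \<in> Q"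
        using BR F(1) by (intro ideal_on_diff[OF I m1] ideal_onD(4)[OF I] G F is_subringD(6)[OF R] evR *)
          (auto simp: coeffs_in_def)
      finally have "r \<in> coeffs_in Q" using F_least *(2,4) by blast
      then show ?thesis using * by blast
    qed
    define T where "T = {q + h * ?v | q h. q \<in> Q \<and> h \<in> R}"
    have T: "ideal_on R T" unfolding T_def by (rule ideal_on_adjoin[OF R I vR])
    have QT: "Q \<subseteq> T"
    proof
      fix q assume "q \<in> Q"
      moreover have "q = q + 0 * ?v" by simp
      ultimately show "q \<in> T" unfolding T_def using is_subringD(3)[OF R] by blast
    qed
    have "?v = 0 + 1 * ?v" by simp
    then have vT: "?v \<in> T" unfolding T_def using ideal_onD(2)[OF I] is_subringD(1)[OF R] by blast
    have "poly F0 \<tau> \<in> T" using F0(2) QT by blast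
    then obtain G where G: "G \<in> coeffs_in B" "poly G \<tau> \<in> T" "lead_coeff G \<notin> Q"
      and G_least: "\<And>G'. G' \<in> coeffs_in B \<Longrightarrow> poly G' \<tau> \<in> T \<Longrightarrow> degree G' < degree G \<Longrightarrow> G' \<in> coeffs_in Q"
      using least_degree_element[OF T QT I R \<tau> B BR F0(1) _ F0(3)] by metis
    let ?c = "lead_coeff G"
    have cB: "?c \<in> B" using G(1) by (auto simp: coeffs_in_def)
    then have cR: "?c ^ k \<in> R" for k using BR is_subringD(6)[OF R] by blast
    have c_pow: "?c ^ k \<notin> Q" for k using prime_on_power[OF Q R] cB BR G(3) by blast
    have "degree G = 0"
    proof (rule ccontr)
      assume "degree G \<noteq> 0"
      then have degG: "degree G > 0" by simp
      have "degree G \<le> degree F"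
      proof (rule ccontr)
        assume "\<not> degree G \<le> degree F"
        then have "F \<in> coeffs_in Q" using G_least[OF F(1)] F(2) QT by auto
        then show False using F(3) by (auto simp: coeffs_in_def)
      qed
      have rem: "\<exists>s q r. q \<in> coeffs_in B \<and> r \<in> coeffs_in Q \<and> smult (?c ^ s) W = q * G + r
          \<and> degree q \<le> degree W - degree G"
        if W: "W \<in> coeffs_in B" "poly W \<tau> \<in> T" for W
      proof -
        obtain s q r where *: "q \<in> coeffs_in B" "r \<in> coeffs_in B"
          "smult (?c ^ s) W = q * G + r" "degree r < degree G" "degree q \<le> degree W - degree G"
          using pseudo_division[OF B G(1) degG W(1)] by blast
        have "r = smult (?c ^ s) W - q * G" using *(3) by simp
        then have "poly r \<tau> = ?c ^ s * poly W \<tau> - poly q \<tau> * poly G \<tau>" by simp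
        also have "\<dots> \<in> T"
          by (intro ideal_on_diff[OF T m1] ideal_onD(4)[OF T] W G cR evR *)
        finally have "r \<in> coeffs_in Q" using G_least *(2,4) by blast
        then show ?thesis using * by blast
      qed
      obtain s q r where 1: "q \<in> coeffs_in B" "r \<in> coeffs_in Q" "smult (?c ^ s) V = q * G + r"
        using rem[OF V(1) vT] by blast
      obtain s' q' r' where 2: "q' \<in> coeffs_in B" "r' \<in> coeffs_in Q" "smult (?c ^ s') F = q' * G + r'"
        "degree q' \<le> degree F - degree G"
        using rem[OF F(1)] F(2) QT by blast
      have "q' * G = smult (?c ^ s') F - r'" using 2(3) by simp
      then have "poly q' \<tau> * poly G \<tau> = ?c ^ s' * poly F \<tau> - poly r' \<tau>"
        by (metis poly_diff poly_mult poly_smult)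
      also have "\<dots> \<in> Q"
        by (intro ideal_on_diff[OF I m1] ideal_onD(4)[OF I] F cR evQ 2)
      finally have "poly q' \<tau> \<in> Q \<or> poly G \<tau> \<in> Q"
        using prime_onD(3)[OF Q evR[OF 2(1)] evR[OF G(1)]] by blast
      then show False
      proof
        assume "poly G \<tau> \<in> Q"
        have "?c ^ s * ?v = poly q \<tau> * poly G \<tau> + poly r \<tau>"
          using arg_cong[OF 1(3), of "\<lambda>p. poly p \<tau>"] by simp
        also have "\<dots> \<in> Q"
          by (intro ideal_onD(3,4)[OF I] evR evQ 1 \<open>poly G \<tau> \<in> Q\<close>)
        finally show False using prime_onD(3)[OF Q cR vR] c_pow V(2) by blast
      next
        assume "poly q' \<tau> \<in> Q"
        moreover have "degree q' < degree F" using 2(4) degG degF by linarith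
        ultimately have "q' \<in> coeffs_in Q" using F_least 2(1) by blast
        then have "G * q' + r' \<in> coeffs_in Q"
          by (intro coeffs_in_closed(1)[OF I m1] clQ G 2)
        then have "smult (?c ^ s') F \<in> coeffs_in Q" by (simp add: 2(3) mult.commute)
        then have "?c ^ s' * lead_coeff F \<in> Q" by (auto simp: coeffs_in_def)
        moreover have "lead_coeff F \<in> R" using F(1) BR by (auto simp: coeffs_in_def)
        ultimately show False using prime_onD(3)[OF Q cR] c_pow F(3) by blast
      qed
    qed
    then have "poly G \<tau> = ?c" by (auto elim: degree_eq_zeroE)
    then obtain q h where qh: "?c = q + h * ?v" "q \<in> Q" "h \<in> R" using G(2) unfolding T_def by auto
    then obtain H where H: "H \<in> coeffs_in B" "h = poly H \<tau>" by (auto simp: R_def)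
    have bH: "?c - poly H \<tau> * ?v \<in> Q" using qh H by simp
    show thesis by (rule algebraic[OF F(1) degF F(3) divF cB G(3) H(1) bH])
  qed
qed

lemma polyfun_subring: "is_subring (polyfun S)"
  unfolding is_subring_def
proof (intro conjI ballI)
  show "1 \<in> polyfun S" unfolding one_fun_def by (rule polyfun.const)
  have "(-1 :: ('a \<Rightarrow> complex) \<Rightarrow> complex) = (\<lambda>_. -1)" by (rule ext) simp
  then show "-1 \<in> polyfun S" using polyfun.const[of "-1" S] by argo
qed (auto simp: plus_fun_def times_fun_def intro: polyfun.intros)

lemma power_fun_apply: "(f ^ k) w = f w ^ k" for f :: "'a \<Rightarrow> complex"
  by (induction k) auto

lemma sum_fun_apply: "(sum f A) w = (\<Sum>a\<in>A. f a w)" for f :: "'b \<Rightarrow> 'a \<Rightarrow> complex"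
  by (induction A rule: infinite_finite_induct) auto

lemma poly_fun_apply:
  fixes F :: "(('v \<Rightarrow> complex) \<Rightarrow> complex) poly"
  shows "poly F (\<lambda>w. w t) w = (\<Sum>i\<le>degree F. coeff F i w * w t ^ i)"
  by (simp add: poly_altdef sum_fun_apply power_fun_apply)

lemma polyfun_insert:
  "polyfun (insert t S) = (\<lambda>F. poly F (\<lambda>w. w t)) ` coeffs_in (polyfun S)"
proof safe
  note cl = coeffs_in_closed[OF is_subring_ideal[OF polyfun_subring[of S]] is_subringD(2)[OF polyfun_subring[of S]]]
  note p1 = is_subringD(1)[OF polyfun_subring]
  fix f assume "f \<in> polyfun (insert t S)"
  then show "f \<in> (\<lambda>F. poly F (\<lambda>w. w t)) ` coeffs_in (polyfun S)"
  proof induction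
    case (const c)
    show ?case
      by (rule image_eqI[of _ _ "monom (\<lambda>_. c) 0"]) (auto simp: poly_monom intro!: cl polyfun.const)
  next
    case (coord v)
    show ?case
    proof (cases "v = t")
      case True
      show ?thesis
        by (rule image_eqI[of _ _ "monom 1 1"]) (auto simp: poly_monom True intro!: cl p1)
    next
      case False
      show ?thesis
        by (rule image_eqI[of _ _ "monom (\<lambda>x. x v) 0"])
          (use coord False in \<open>auto simp: poly_monom intro!: cl polyfun.coord\<close>)
    qed
  next
    case (add f g)
    then obtain F G where "F \<in> coeffs_in (polyfun S)" "f = poly F (\<lambda>w. w t)"
      "G \<in> coeffs_in (polyfun S)" "g = poly G (\<lambda>w. w t)" by auto
    then show ?case
      by (intro image_eqI[of _ _ "F + G"]) (auto intro!: cl)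
  next
    case (mult f g)
    then obtain F G where "F \<in> coeffs_in (polyfun S)" "f = poly F (\<lambda>w. w t)"
      "G \<in> coeffs_in (polyfun S)" "g = poly G (\<lambda>w. w t)" by auto
    then show ?case
      by (intro image_eqI[of _ _ "F * G"]) (auto intro!: cl)
  qed
next
  fix F assume F: "F \<in> coeffs_in (polyfun S)"
  have "(\<lambda>w. \<Sum>i\<le>degree F. coeff F i w * w t ^ i) \<in> polyfun (insert t S)"
    using F polyfun_mono[of S "insert t S"]
    by (intro polyfun_sum polyfun.mult polyfun_power polyfun.coord) (auto simp: coeffs_in_def)
  also have "(\<lambda>w. \<Sum>i\<le>degree F. coeff F i w * w t ^ i) = poly F (\<lambda>w. w t)"
    by (rule ext) (rule poly_fun_apply[symmetric])
  finally show "poly F (\<lambda>w. w t) \<in> polyfun (insert t S)" .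
qed

definition specialize :: "('v \<Rightarrow> complex) \<Rightarrow> (('v \<Rightarrow> complex) \<Rightarrow> complex) poly \<Rightarrow> complex poly" where
  "specialize w F = (\<Sum>i\<le>degree F. monom (coeff F i w) i)"

lemma coeff_specialize: "coeff (specialize w F) k = coeff F k w"
proof (cases "k \<le> degree F")
  case True
  then show ?thesis by (simp add: specialize_def coeff_sum)
next
  case False
  then show ?thesis by (simp add: specialize_def coeff_sum coeff_eq_0)
qed

lemma poly_specialize:
  assumes "F \<in> coeffs_in (polyfun S)" "t \<notin> S"
  shows "poly F (\<lambda>w. w t) (w(t := z)) = poly (specialize w F) z"
proof -
  have "coeff F i (w(t := z)) = coeff F i w" for i
    by (rule polyfun_cong[of _ S]) (use assms in \<open>auto simp: coeffs_in_def\<close>)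
  then show ?thesis
    by (simp add: poly_fun_apply specialize_def poly_sum poly_monom)
qed

text \<open>A zero \<open>w\<close> of the contraction of \<open>Q\<close> to the variables \<open>U\<close> can be completed in the variables \<open>X\<close> to a
  zero of \<open>Q\<close> itself, as soon as \<open>P w \<noteq> 0\<close>.  Requiring \<open>v \<noteq> 0\<close> at the new point is what lets such
  steps be composed.\<close>

definition lifts_points ::
  "'v set \<Rightarrow> 'v set \<Rightarrow> (('v \<Rightarrow> complex) \<Rightarrow> complex) set \<Rightarrow>
    (('v \<Rightarrow> complex) \<Rightarrow> complex) \<Rightarrow> (('v \<Rightarrow> complex) \<Rightarrow> complex) \<Rightarrow> bool" where
  "lifts_points U X Q P v \<longleftrightarrow> (\<forall>w. (\<forall>q\<in>Q \<inter> polyfun U. q w = 0) \<and> P w \<noteq> 0 \<longrightarrow>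
    (\<exists>w'. (\<forall>i. i \<notin> X \<longrightarrow> w' i = w i) \<and> (\<forall>q\<in>Q. q w' = 0) \<and> v w' \<noteq> 0))"

lemma lifts_pointsD:
  assumes "lifts_points U X Q P v" "\<And>q. q \<in> Q \<Longrightarrow> q \<in> polyfun U \<Longrightarrow> q w = 0" "P w \<noteq> 0"
  obtains w' where "\<And>i. i \<notin> X \<Longrightarrow> w' i = w i" "\<And>q. q \<in> Q \<Longrightarrow> q w' = 0" "v w' \<noteq> 0"
proof -
  have "(\<forall>q\<in>Q \<inter> polyfun U. q w = 0) \<and> P w \<noteq> 0" using assms by simp
  from assms(1)[unfolded lifts_points_def, THEN spec, THEN mp, OF this]
  obtain w' where "(\<forall>i. i \<notin> X \<longrightarrow> w' i = w i) \<and> (\<forall>q\<in>Q. q w' = 0) \<and> v w' \<noteq> 0" by (rule exE)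
  then show thesis by (intro that[of w']) simp_all
qed

lemma lifts_points_trans:
  assumes Q: "lifts_points S Y Q b v" and P: "lifts_points U X (Q \<inter> polyfun S) P b"
    and sub: "polyfun U \<subseteq> polyfun S"
  shows "lifts_points U (X \<union> Y) Q P v"
  unfolding lifts_points_def
proof (intro allI impI)
  fix w assume w: "(\<forall>q\<in>Q \<inter> polyfun U. q w = 0) \<and> P w \<noteq> 0"
  obtain w1 where w1: "\<And>i. i \<notin> X \<Longrightarrow> w1 i = w i" "\<And>q. q \<in> Q \<inter> polyfun S \<Longrightarrow> q w1 = 0" "b w1 \<noteq> 0"
    by (rule lifts_pointsD[OF P, of w]) (use w in auto)
  obtain w2 where w2: "\<And>i. i \<notin> Y \<Longrightarrow> w2 i = w1 i" "\<And>q. q \<in> Q \<Longrightarrow> q w2 = 0" "v w2 \<noteq> 0"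
    by (rule lifts_pointsD[OF Q, of w1]) (use w1 in auto)
  show "\<exists>w'. (\<forall>i. i \<notin> X \<union> Y \<longrightarrow> w' i = w i) \<and> (\<forall>q\<in>Q. q w' = 0) \<and> v w' \<noteq> 0"
    using w1(1) w2 by (intro exI[of _ w2]) simp
qed

text \<open>A transcendental coordinate may take every value but finitely many; it suffices to keep one
  coefficient of \<open>v\<close> outside \<open>Q\<close> nonzero.  An algebraic coordinate is chosen as a root of its
  polynomial \<open>F\<close> of least degree, whose leading coefficient must not vanish; then \<open>Q\<close> vanishes by
  pseudo-division, and \<open>v\<close> divides \<open>b\<close> modulo \<open>Q\<close>.\<close>

lemma prime_points_lift_one:
  fixes v :: "('v \<Rightarrow> complex) \<Rightarrow> complex"
  assumes t: "t \<notin> S" and Q: "prime_on (polyfun (insert t S)) Q"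
    and v: "v \<in> polyfun (insert t S)" "v \<notin> Q"
  shows "\<exists>b\<in>polyfun S. b \<notin> Q \<and> lifts_points S {t} Q b v"
proof -
  let ?B = "polyfun S"
  let ?\<tau> = "\<lambda>w :: 'v \<Rightarrow> complex. w t"
  have I: "ideal_on (polyfun (insert t S)) Q" by (rule prime_onD(1)[OF Q])
  have Q_poly: "\<exists>G\<in>coeffs_in ?B. q = poly G ?\<tau>" if "q \<in> Q" for q
    using that ideal_onD(1)[OF I] polyfun_insert[of t S] by auto
  have vanish: "poly G ?\<tau> (w(t := z)) = 0"
    if "G \<in> coeffs_in ?B" "G \<in> coeffs_in Q" "\<forall>q\<in>Q \<inter> ?B. q w = 0" for G w z
  proof -
    have "coeff G k w = 0" for k using that by (auto simp: coeffs_in_def)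
    then have "specialize w G = 0" by (intro poly_eqI) (simp add: coeff_specialize)
    then show ?thesis by (simp add: poly_specialize[OF that(1) t])
  qed
  obtain V where V: "V \<in> coeffs_in ?B" "v = poly V ?\<tau>" using v polyfun_insert[of t S] by auto
  have "poly V ?\<tau> \<notin> Q" using V v by simp
  from polyfun_subring polyfun_insert polyfun_subring Q V(1) this
  show ?thesis
  proof (cases rule: prime_simple_extension)
    case transcendental
    then obtain k where k: "coeff V k \<notin> Q" by (auto simp: coeffs_in_def)
    show ?thesis
      unfolding lifts_points_def
    proof (intro bexI[of _ "coeff V k"] conjI allI impI)
      fix w assume w: "(\<forall>q\<in>Q \<inter> ?B. q w = 0) \<and> coeff V k w \<noteq> 0"
      then have "specialize w V \<noteq> 0" by (metis coeff_0 coeff_specialize)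
      then obtain z where "poly (specialize w V) z \<noteq> 0" using poly_all_0_iff_0 by blast
      then have "v (w(t := z)) \<noteq> 0" by (simp add: V poly_specialize[OF V(1) t])
      moreover have "q (w(t := z)) = 0" if q: "q \<in> Q" for q
      proof -
        obtain G where G: "G \<in> coeffs_in ?B" "q = poly G ?\<tau>" using Q_poly[OF q] by blast
        then have "G \<in> coeffs_in Q" using transcendental(1) q by blast
        then show ?thesis using vanish[OF G(1)] w G(2) by blast
      qed
      ultimately show "\<exists>w'. (\<forall>i. i \<notin> {t} \<longrightarrow> w' i = w i) \<and> (\<forall>q\<in>Q. q w' = 0) \<and> v w' \<noteq> 0"
        by (intro exI[of _ "w(t := z)"]) simp
    qed (use k V in \<open>auto simp: coeffs_in_def\<close>)
  next
    case (algebraic F b H)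
    let ?a = "lead_coeff F"
    have a: "?a \<in> ?B" using algebraic(1) by (auto simp: coeffs_in_def)
    have subB: "?B \<subseteq> polyfun (insert t S)" by (rule polyfun_mono) auto
    show ?thesis
      unfolding lifts_points_def
    proof (intro bexI[of _ "?a * b"] conjI allI impI)
      show "?a * b \<in> ?B" using is_subringD(5)[OF polyfun_subring a algebraic(5)] .
      show "?a * b \<notin> Q"
        using prime_onD(3)[OF Q] a algebraic(3,5,6) subB by blast
    next
      fix w assume w: "(\<forall>q\<in>Q \<inter> ?B. q w = 0) \<and> (?a * b) w \<noteq> 0"
      then have w0: "\<forall>q\<in>Q \<inter> ?B. q w = 0" and aw: "?a w \<noteq> 0" and bw: "b w \<noteq> 0" by auto
      have "degree F \<le> degree (specialize w F)"
        by (rule le_degree) (use aw in \<open>simp add: coeff_specialize\<close>)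
      then have "\<not> constant (poly (specialize w F))"
        using algebraic(2) by (simp add: constant_degree)
      then obtain z where z: "poly (specialize w F) z = 0"
        using fundamental_theorem_of_algebra by blast
      let ?w = "w(t := z)"
      have indep: "c ?w = c w" if "c \<in> ?B" for c
        by (rule polyfun_cong[OF that]) (use t in auto)
      have Fz: "poly F ?\<tau> ?w = 0" using z by (simp add: poly_specialize[OF algebraic(1) t])
      have zero: "q ?w = 0" if q: "q \<in> Q" for q
      proof -
        obtain G where G: "G \<in> coeffs_in ?B" "q = poly G ?\<tau>" using Q_poly[OF q] by blast
        then obtain s p r where *: "r \<in> coeffs_in ?B" "r \<in> coeffs_in Q"
          "smult (?a ^ s) G = p * F + r"
          using algebraic(4) q by metis
        have "?a ^ s * poly G ?\<tau> = poly p ?\<tau> * poly F ?\<tau> + poly r ?\<tau>"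
          using arg_cong[OF *(3), of "\<lambda>p. poly p ?\<tau>"] by simp
        from fun_cong[OF this, of ?w]
        have "?a w ^ s * q ?w = poly p ?\<tau> ?w * poly F ?\<tau> ?w + poly r ?\<tau> ?w"
          by (simp add: G(2) power_fun_apply indep[OF a])
        also have "\<dots> = 0" by (simp add: Fz vanish[OF *(1,2) w0])
        finally show ?thesis using aw by simp
      qed
      have "(b - poly H ?\<tau> * poly V ?\<tau>) ?w = 0" by (rule zero[OF algebraic(8)])
      then have "poly H ?\<tau> ?w * v ?w = b w" by (simp add: V(2) indep[OF algebraic(5)])
      then have "v ?w \<noteq> 0" using bw by auto
      then show "\<exists>w'. (\<forall>i. i \<notin> {t} \<longrightarrow> w' i = w i) \<and> (\<forall>q\<in>Q. q w' = 0) \<and> v w' \<noteq> 0"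
        using zero by (intro exI[of _ ?w]) simp
    qed
  qed
qed

lemma prime_points_lift:
  assumes "finite X" "X \<inter> U = {}" "prime_on (polyfun (U \<union> X)) Q" "v \<in> polyfun (U \<union> X)" "v \<notin> Q"
  shows "\<exists>P\<in>polyfun U. P \<notin> Q \<and> lifts_points U X Q P v"
  using assms
proof (induction X arbitrary: Q v)
  case empty
  have "Q \<subseteq> polyfun U" using ideal_onD(1)[OF prime_onD(1)[OF empty(2)]] by simp
  then have "lifts_points U {} Q v v"
    unfolding lifts_points_def
    by (intro allI impI, rule_tac x = w in exI) auto
  then show ?case using empty by auto
next
  case (insert t X)
  let ?S = "U \<union> X"
  have t: "t \<notin> ?S" using insert by auto
  have Q: "prime_on (polyfun (insert t ?S)) Q" and v: "v \<in> polyfun (insert t ?S)" "v \<notin> Q"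
    using insert.prems by simp_all
  have sub: "polyfun ?S \<subseteq> polyfun (insert t ?S)" "polyfun U \<subseteq> polyfun ?S"
    by (rule polyfun_mono; auto)+
  obtain b where b: "b \<in> polyfun ?S" "b \<notin> Q" "lifts_points ?S {t} Q b v"
    using prime_points_lift_one[OF t Q v] by blast
  let ?Q = "Q \<inter> polyfun ?S"
  note I = ideal_onD[OF prime_onD(1)[OF Q]]
  note R = is_subringD[OF polyfun_subring[of ?S]]
  have "ideal_on (polyfun ?S) ?Q"
    unfolding ideal_on_def
  proof (intro conjI ballI)
    show "0 \<in> ?Q" using I(2) R(3) by simp
    show "a + b \<in> ?Q" if "a \<in> ?Q" "b \<in> ?Q" for a b using that I(3) R(4) by simp
    show "a * b \<in> ?Q" if "a \<in> polyfun ?S" "b \<in> ?Q" for a b using that I(4) R(5) sub(1) by blast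
  qed simp
  then have "prime_on (polyfun ?S) ?Q"
    unfolding prime_on_def using prime_onD(2,3)[OF Q] sub(1) by blast
  moreover have "X \<inter> U = {}" using insert.prems(1) by blast
  moreover have "b \<notin> ?Q" using b(2) by blast
  ultimately obtain P where P: "P \<in> polyfun U" "P \<notin> ?Q" "lifts_points U X ?Q P b"
    using insert.IH[of ?Q b] b(1) by blast
  have "lifts_points U (X \<union> {t}) Q P v"
    by (rule lifts_points_trans[OF b(3) P(3) sub(2)])
  then show ?case using P(1,2) sub(2) by (intro bexI[of _ P]) auto
qed

text \<open>Maximality of a prime \<open>Q\<close> above \<open>E\<close> that avoids all nonzero functions of the variables \<open>U\<close> makes
  its contraction to \<open>U\<close> zero, so every \<open>w\<close> is a zero of the contraction.\<close>

theorem generic_point_of_ideal: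
  fixes E :: "(('v \<Rightarrow> complex) \<Rightarrow> complex) set"
  assumes X: "finite X" "X \<inter> U = {}" and E: "ideal_on (polyfun (U \<union> X)) E"
    and EU: "\<And>D. D \<in> E \<Longrightarrow> D \<in> polyfun U \<Longrightarrow> D = 0"
  shows "\<exists>P\<in>polyfun U. P \<noteq> 0 \<and> (\<forall>w. P w \<noteq> 0 \<longrightarrow>
    (\<exists>w'. (\<forall>i. i \<notin> X \<longrightarrow> w' i = w i) \<and> (\<forall>q\<in>E. q w' = 0)))"
proof -
  let ?M = "polyfun U - {0}"
  have R: "is_subring (polyfun (U \<union> X))" by (rule polyfun_subring)
  have "a * b \<in> ?M" if ab: "a \<in> ?M" "b \<in> ?M" for a b
  proof -
    obtain x where x: "a x \<noteq> 0" using ab by (auto simp: fun_eq_iff)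
    obtain y where y: "b y \<noteq> 0" using ab by (auto simp: fun_eq_iff)
    have "a \<in> polyfun U" "b \<in> polyfun U" using ab by auto
    from polyfun_common_nonzero[OF this(1) x this(2) y]
    have "a * b \<noteq> 0" by (auto simp: fun_eq_iff)
    then show ?thesis using ab is_subringD(5)[OF polyfun_subring[of U]] by auto
  qed
  moreover have "1 \<in> ?M" using is_subringD(1)[OF polyfun_subring[of U]] by auto
  moreover have "E \<inter> ?M = {}" using EU by auto
  ultimately obtain Q where Q: "prime_on (polyfun (U \<union> X)) Q" "E \<subseteq> Q" "Q \<inter> ?M = {}"
    using prime_ideal_avoiding[OF R E, of ?M] by metis
  have one: "1 \<notin> Q" "1 \<in> polyfun (U \<union> X)" using prime_onD(2)[OF Q(1)] is_subringD(1)[OF R] by auto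
  obtain P where P: "P \<in> polyfun U" "P \<notin> Q" "lifts_points U X Q P 1"
    using prime_points_lift[OF X Q(1) one(2,1)] by blast
  have "0 \<in> Q" by (rule ideal_onD(2)[OF prime_onD(1)[OF Q(1)]])
  then have "P \<noteq> 0" using P(2) by blast
  moreover have "\<exists>w'. (\<forall>i. i \<notin> X \<longrightarrow> w' i = w i) \<and> (\<forall>q\<in>E. q w' = 0)" if "P w \<noteq> 0" for w
  proof -
    have "q w = 0" if "q \<in> Q" "q \<in> polyfun U" for q
    proof -
      have "q = 0" using that Q(3) by blast
      then show ?thesis by simp
    qed
    then obtain w' where "\<And>i. i \<notin> X \<Longrightarrow> w' i = w i" "\<And>q. q \<in> Q \<Longrightarrow> q w' = 0"
      "(1 :: ('v \<Rightarrow> complex) \<Rightarrow> complex) w' \<noteq> 0"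
      by (rule lifts_pointsD[OF P(3) _ \<open>P w \<noteq> 0\<close>]) (use that in auto)
    then show ?thesis using Q(2) by (intro exI[of _ w']) auto
  qed
  ultimately show ?thesis using P(1) by blast
qed

section \<open>Few equations leave a large variety\<close>

lemma mpoly_eval_at_0: "mpoly_eval p (\<lambda>_. 0) = Poly_Mapping.lookup p 0"
  for p :: "('v, 'a::comm_ring_1) mpoly"
  unfolding mpoly_eval_eq_ev
proof (induction p rule: mpoly_induct)
  case (single m c)
  have "monomial_val m (\<lambda>_. 0 :: 'a) = (if m = 0 then 1 else 0)"
  proof (cases "m = 0")
    case False
    then obtain v where "v \<in> Poly_Mapping.keys m" by (metis all_not_in_conv keys_eq_empty)
    then have "\<exists>v\<in>Poly_Mapping.keys m. (0 :: 'a) ^ Poly_Mapping.lookup m v = 0"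
      by (intro bexI[of _ v]) (auto simp: in_keys_iff zero_power)
    then show ?thesis using False unfolding monomial_val_def by (simp only: prod_zero finite_keys if_False)
  qed simp
  then show ?case by (simp add: idh.ev_single lookup_single when_def)
qed (simp_all add: idh.ev_add lookup_add)

text \<open>The translation of \<open>independent_coordinates_exist\<close> to polynomial functions.\<close>

lemma independent_coordinates_polyfun:
  fixes gs :: "(('n::finite \<Rightarrow> complex) \<Rightarrow> complex) list"
  assumes len: "length gs < CARD('n)"
    and gs_all: "\<forall>g\<in>set gs. g \<in> polyfun UNIV \<and> g (\<lambda>_. 0) = 0"
  shows "\<exists>J :: 'n set. card J = CARD('n) - length gs \<and>
    (\<forall>D h. D \<in> polyfun J \<longrightarrow> (\<forall>i. h i \<in> polyfun UNIV) \<longrightarrow>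
      (\<forall>x. D x = (\<Sum>i<length gs. h i x * (gs ! i) x)) \<longrightarrow> (\<forall>x. D x = 0))"
proof -
  have gs: "g \<in> polyfun UNIV" "g (\<lambda>_. 0) = 0" if "g \<in> set gs" for g
    using gs_all that by blast+
  define repr where "repr f = (SOME p. \<forall>x. f x = mpoly_eval p x)"
    for f :: "('n \<Rightarrow> complex) \<Rightarrow> complex"
  have repr: "f x = mpoly_eval (repr f) x" if "f \<in> polyfun UNIV" for f x
  proof -
    have "\<exists>p. \<forall>x. f x = mpoly_eval p x" using polyfun_imp_mpoly[OF that] by blast
    from someI_ex[OF this] show ?thesis unfolding repr_def by blast
  qed
  have "\<And>g. g \<in> set (map repr gs) \<Longrightarrow> Poly_Mapping.lookup g 0 = 0"
    using repr gs by (auto simp flip: mpoly_eval_at_0)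
  moreover have "length (map repr gs) < CARD('n)" using len by simp
  ultimately obtain J :: "'n set" where J: "card J = CARD('n) - length (map repr gs)"
    "\<And>D. D \<in> gen_ideal (map repr gs) \<Longrightarrow> mpoly_vars D \<subseteq> J \<Longrightarrow> D = 0"
    using independent_coordinates_exist by metis
  show ?thesis
  proof (intro exI[of _ J] conjI allI impI)
    show "card J = CARD('n) - length gs" using J(1) by simp
  next
    fix D h x
    assume D: "D \<in> polyfun J" and "\<forall>i. h i \<in> polyfun UNIV"
      and sum: "\<forall>x. D x = (\<Sum>i<length gs. h i x * (gs ! i) x)"
    then have h: "h i \<in> polyfun UNIV" for i by blast
    obtain p where p: "mpoly_vars p \<subseteq> J" "\<And>x. D x = mpoly_eval p x"
      using polyfun_imp_mpoly[OF D] by blast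
    let ?q = "\<Sum>i<length gs. repr (h i) * repr (gs ! i)"
    have "mpoly_eval (p - ?q) x = 0" for x
    proof -
      have "mpoly_eval p x = mpoly_eval ((p - ?q) + ?q) x" by simp
      also have "\<dots> = mpoly_eval (p - ?q) x + mpoly_eval ?q x" by (simp only: mpoly_eval_add)
      finally have "mpoly_eval (p - ?q) x = D x - mpoly_eval ?q x" by (simp add: p(2))
      also have "mpoly_eval ?q x = (\<Sum>i<length gs. h i x * (gs ! i) x)"
        unfolding mpoly_eval_eq_ev idh.ev_sum idh.ev_mult
        by (intro sum.cong) (simp_all add: repr[OF h] repr[OF gs(1)] mpoly_eval_eq_ev)
      finally show ?thesis by (simp add: sum)
    qed
    then have "p - ?q = 0" using mpoly_eval_nonzero by blast
    then have "p = ?q" by simp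
    then have "p \<in> gen_ideal (map repr gs)"
      by (auto simp: gen_ideal_def intro!: exI[of _ "\<lambda>i. repr (h i)"] sum.cong)
    then have "p = 0" using J(2) p(1) by blast
    then show "D x = 0" by (simp add: p(2) mpoly_eval_def)
  qed
qed

text \<open>The counterpart of \<open>gen_ideal\<close> relative to a subring.\<close>

definition ideal_gen :: "'r::comm_ring_1 set \<Rightarrow> nat \<Rightarrow> (nat \<Rightarrow> 'r) \<Rightarrow> 'r set" where
  "ideal_gen R n f = {\<Sum>i<n. h i * f i | h. \<forall>i. h i \<in> R}"

lemma ideal_on_ideal_gen:
  assumes R: "is_subring R" and f: "\<And>i. i < n \<Longrightarrow> f i \<in> R"
  shows "ideal_on R (ideal_gen R n f)"
  unfolding ideal_on_def
proof (intro conjI ballI)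
  show "ideal_gen R n f \<subseteq> R"
    using f by (auto simp: ideal_gen_def intro!: ideal_on_sum[OF is_subring_ideal[OF R]] is_subringD(5)[OF R])
  show "0 \<in> ideal_gen R n f"
    unfolding ideal_gen_def by (rule CollectI, rule exI[of _ "\<lambda>_. 0"]) (simp add: is_subringD(3)[OF R])
next
  fix a b assume "a \<in> ideal_gen R n f" "b \<in> ideal_gen R n f"
  then obtain h h' where *: "a = (\<Sum>i<n. h i * f i)" "b = (\<Sum>i<n. h' i * f i)"
    "\<forall>i. h i \<in> R" "\<forall>i. h' i \<in> R" by (auto simp: ideal_gen_def)
  have "a + b = (\<Sum>i<n. (h i + h' i) * f i)" by (simp add: * distrib_right sum.distrib)
  moreover have "\<forall>i. h i + h' i \<in> R" using * is_subringD(4)[OF R] by blast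
  ultimately show "a + b \<in> ideal_gen R n f"
    unfolding ideal_gen_def by (intro CollectI exI[of _ "\<lambda>i. h i + h' i"] conjI)
next
  fix r a assume "r \<in> R" "a \<in> ideal_gen R n f"
  then obtain h where *: "a = (\<Sum>i<n. h i * f i)" "\<forall>i. h i \<in> R" by (auto simp: ideal_gen_def)
  have "r * a = (\<Sum>i<n. (r * h i) * f i)" by (simp add: * sum_distrib_left mult.assoc)
  moreover have "\<forall>i. r * h i \<in> R" using * \<open>r \<in> R\<close> is_subringD(5)[OF R] by blast
  ultimately show "r * a \<in> ideal_gen R n f"
    unfolding ideal_gen_def by (intro CollectI exI[of _ "\<lambda>i. r * h i"] conjI)
qed

lemma ideal_gen_generator:
  assumes R: "is_subring R" and "i < n"
  shows "f i \<in> ideal_gen R n f"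
proof -
  have "f i = (\<Sum>j<n. (if j = i then 1 else 0) * f j)"
    using assms(2) by (simp add: if_distrib[of "\<lambda>t. t * _"] cong: if_cong)
  then show ?thesis
    unfolding ideal_gen_def
    by (intro CollectI exI[of _ "\<lambda>j. if j = i then 1 else 0"]) (simp add: is_subringD(1,3)[OF R])
qed

text \<open>The incidence variety consists of the points of the zero set of \<open>bs\<close> together with hyperplanes
  through them.  \<open>Inl a\<close> is the coordinate \<open>a\<close> of the point, and \<open>Inr (j, _)\<close> is a coefficient of the
  hyperplane \<open>j\<close>.  The equations of the hyperplanes are numbered after those of the point.\<close>

type_synonym 'n incidence_var = "'n + nat \<times> 'n option"

definition incidence_gens ::
  "(('n::finite \<Rightarrow> complex) \<Rightarrow> complex) list \<Rightarrow> nat \<Rightarrow> ('n incidence_var \<Rightarrow> complex) \<Rightarrow> complex" where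
  "incidence_gens bs i = (\<lambda>w.
    if i < length bs then (bs ! i) (\<lambda>a. w (Inl a))
    else (\<Sum>a\<in>UNIV. w (Inr (i - length bs, Some a)) * w (Inl a)) + w (Inr (i - length bs, None)))"

text \<open>Choose the normal vectors as \<open>d\<close> rows of a matrix \<open>T\<close>, and the constant terms so that the
  hyperplanes pass through the point \<open>x\<close>.  The constant terms are then \<open>d\<close> of the affine coordinates
  \<open>y = T(x - p)\<close>, up to sign and translation.  The hyperplane equations hold identically, so \<open>D\<close>
  becomes a polynomial in these \<open>d\<close> coordinates that lies in the ideal generated by \<open>bs\<close>.  For
  generic \<open>T\<close> it is nonzero for every choice of \<open>d\<close> rows, but some \<open>d\<close> coordinates are independent.\<close>

lemma incidence_elimination:
  fixes bs :: "(('n::finite \<Rightarrow> complex) \<Rightarrow> complex) list"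
  assumes bs: "\<And>b. b \<in> set bs \<Longrightarrow> b \<in> polyfun UNIV" "\<And>b. b \<in> set bs \<Longrightarrow> b p = 0"
    and len: "length bs < CARD('n)" and d: "d = CARD('n) - length bs"
    and D: "D \<in> polyfun (Inr ` ({..<d} \<times> UNIV))"
    and h: "\<And>i. h i \<in> polyfun UNIV"
    and sum: "\<And>w. D w = (\<Sum>i<CARD('n). h i w * incidence_gens bs i w)"
  shows "D w0 = 0"
proof (rule ccontr)
  assume w0: "D w0 \<noteq> 0"
  let ?U = "Inr ` ({..<d} \<times> UNIV) :: 'n incidence_var set"
  obtain \<sigma> where \<sigma>: "\<And>J :: 'n set. card J = d \<Longrightarrow> bij_betw (\<sigma> J) {..<d} J"
  proof -
    have "\<exists>s. card J = d \<longrightarrow> bij_betw s {..<d} J" for J :: "'n set"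
      using ex_bij_betw_nat_finite[of J] by (auto simp: atLeast0LessThan)
    then show ?thesis using that by metis
  qed
  define \<sigma>' where "\<sigma>' J = inv_into {..<d} (\<sigma> J)" for J
  have \<sigma>': "\<sigma>' J (\<sigma> J j) = j" if "card J = d" "j < d" for J j
    unfolding \<sigma>'_def by (rule bij_betw_inv_into_left[OF \<sigma>[OF that(1)]]) (use that in auto)
  have \<sigma>_in: "\<sigma> J j \<in> J" if "card J = d" "j < d" for J j
    using \<sigma>[OF that(1)] that(2) by (auto simp: bij_betw_def)
  \<comment> \<open>Row \<open>\<sigma> J j\<close> of \<open>T\<close> is the \<open>j\<close>-th normal vector.  The constant terms stay those of \<open>w0\<close>, so that
    the tests on \<open>T\<close> involve finitely many polynomials in \<open>T\<close> alone.\<close>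
  define asgT :: "'n set \<Rightarrow> ('n \<times> 'n \<Rightarrow> complex) \<Rightarrow> 'n incidence_var \<Rightarrow> complex" where
    "asgT J T v = (case v of Inr (j, Some a) \<Rightarrow> T (\<sigma> J j, a) | _ \<Rightarrow> w0 v)" for J T v
  define test :: "'n set option \<Rightarrow> ('n \<times> 'n \<Rightarrow> complex) \<Rightarrow> complex" where
    "test A T = (case A of None \<Rightarrow> det (\<chi> i a. T (i, a)) | Some J \<Rightarrow> D (asgT J T))" for A T
  have "\<exists>T. \<forall>A\<in>insert None (Some ` {J. card J = d}). test A T \<noteq> 0"
  proof (rule polyfun_common_nonzero_finite)
    fix A :: "'n set option" assume A: "A \<in> insert None (Some ` {J. card J = d})"
    show "test A \<in> polyfun UNIV"
    proof (cases A)
      case None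
      have "(\<lambda>T. det (\<chi> i a. T (i, a) :: complex ^ 'n ^ 'n)) \<in> polyfun UNIV"
        by (rule polyfun_det) (simp add: polyfun.coord)
      also have "(\<lambda>T. det (\<chi> i a. T (i, a) :: complex ^ 'n ^ 'n)) = test A"
        by (rule ext) (simp add: None test_def)
      finally show ?thesis .
    next
      case (Some J)
      have "(\<lambda>T. D (asgT J T)) \<in> polyfun UNIV"
      proof (rule polyfun_subst[OF D])
        fix v assume "v \<in> ?U"
        then obtain j b where v: "v = Inr (j, b)" by blast
        show "(\<lambda>T. asgT J T v) \<in> polyfun UNIV"
          by (cases b) (simp_all add: asgT_def v polyfun.const polyfun.coord)
      qed
      also have "(\<lambda>T. D (asgT J T)) = test A"
        by (rule ext) (simp add: Some test_def)
      finally show ?thesis .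
    qed
    show "\<exists>T. test A T \<noteq> 0"
    proof (cases A)
      case None
      have "test A (\<lambda>(i, a). if i = a then 1 else 0) = det (mat 1 :: complex ^ 'n ^ 'n)"
        by (simp add: None test_def mat_def)
      then show ?thesis by (intro exI[of _ "\<lambda>(i, a). if i = a then 1 else 0"]) simp
    next
      case (Some J)
      then have J: "card J = d" using A by auto
      have "D (asgT J (\<lambda>(i, a). w0 (Inr (\<sigma>' J i, Some a)))) = D w0"
        by (rule polyfun_cong[OF D]) (auto simp: asgT_def \<sigma>'[OF J] split: option.split)
      then show ?thesis
        using w0 Some by (intro exI[of _ "\<lambda>(i, a). w0 (Inr (\<sigma>' J i, Some a))"]) (simp add: test_def)
    qed
  qed simp
  then obtain T where T_det: "test None T \<noteq> 0" and T_D: "\<And>J. card J = d \<Longrightarrow> D (asgT J T) \<noteq> 0"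
    by (auto simp: test_def)
  have "invertible (\<chi> i a. T (i, a) :: complex ^ 'n ^ 'n)"
    using T_det by (simp add: test_def invertible_det_nz)
  then obtain S :: "complex ^ 'n ^ 'n" where S: "(\<chi> i a. T (i, a)) ** S = mat 1"
    unfolding invertible_def by blast
  have TS: "(\<Sum>a\<in>UNIV. T (i, a) * S $ a $ b) = (if i = b then 1 else 0)" for i b
  proof -
    have "(\<Sum>a\<in>UNIV. T (i, a) * S $ a $ b) = ((\<chi> i a. T (i, a)) ** S) $ i $ b"
      by (simp add: matrix_matrix_mult_def)
    then show ?thesis by (simp add: S mat_def)
  qed
  \<comment> \<open>the point \<open>p + T\<inverse> y\<close>\<close>
  define point where "point y a = p a + (\<Sum>b\<in>UNIV. S $ a $ b * y b)" for y a
  have point_0: "point (\<lambda>_. 0) = p" by (rule ext) (simp add: point_def)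
  have point_poly: "(\<lambda>y. point y a) \<in> polyfun UNIV" for a
    unfolding point_def by (intro polyfun_intros) simp_all
  have Tpoint: "(\<Sum>a\<in>UNIV. T (i, a) * point y a) = (\<Sum>a\<in>UNIV. T (i, a) * p a) + y i" for i y
  proof -
    have "(\<Sum>a\<in>UNIV. T (i, a) * point y a) = (\<Sum>a\<in>UNIV. T (i, a) * p a)
        + (\<Sum>a\<in>UNIV. \<Sum>b\<in>UNIV. T (i, a) * S $ a $ b * y b)"
      by (simp add: point_def distrib_left sum.distrib sum_distrib_left mult.assoc)
    also have "(\<Sum>a\<in>UNIV. \<Sum>b\<in>UNIV. T (i, a) * S $ a $ b * y b)
        = (\<Sum>b\<in>UNIV. (\<Sum>a\<in>UNIV. T (i, a) * S $ a $ b) * y b)"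
      by (subst sum.swap) (simp add: sum_distrib_right)
    also have "\<dots> = y i" by (simp add: TS if_distrib[of "\<lambda>t. t * _"] cong: if_cong)
    finally show ?thesis .
  qed
  define gs where "gs = map (\<lambda>b y. b (point y)) bs"
  have gs_poly: "g \<in> polyfun UNIV" if "g \<in> set gs" for g
  proof -
    have "g \<in> (\<lambda>b y. b (point y)) ` set bs" using that by (simp add: gs_def)
    then obtain b where b: "g = (\<lambda>y. b (point y))" "b \<in> set bs" by (rule imageE)
    show ?thesis unfolding b(1) by (rule polyfun_subst[OF bs(1)[OF b(2)]]) (rule point_poly)
  qed
  have gs_0: "g (\<lambda>_. 0) = 0" if "g \<in> set gs" for g
    using that bs(2) point_0 by (auto simp: gs_def)
  have len_gs: "length gs = length bs" by (simp add: gs_def)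
  have "length gs < CARD('n)" using len by (simp add: len_gs)
  moreover have "\<forall>g\<in>set gs. g \<in> polyfun UNIV \<and> g (\<lambda>_. 0) = 0" using gs_poly gs_0 by simp
  ultimately have "\<exists>J :: 'n set. card J = CARD('n) - length gs \<and>
      (\<forall>D h. D \<in> polyfun J \<longrightarrow> (\<forall>i. h i \<in> polyfun UNIV) \<longrightarrow>
        (\<forall>x. D x = (\<Sum>i<length gs. h i x * (gs ! i) x)) \<longrightarrow> (\<forall>x. D x = 0))"
    by (rule independent_coordinates_polyfun)
  then
  obtain J :: "'n set" where J_all: "card J = CARD('n) - length gs \<and>
      (\<forall>D h. D \<in> polyfun J \<longrightarrow> (\<forall>i. h i \<in> polyfun UNIV) \<longrightarrow>
        (\<forall>x. D x = (\<Sum>i<length gs. h i x * (gs ! i) x)) \<longrightarrow> (\<forall>x. D x = 0))"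
    by (rule exE)
  then have J: "card J = d" by (simp add: len_gs d)
  note indep = conjunct2[OF J_all, rule_format]
  define asg where "asg y v = (case v of Inl a \<Rightarrow> point y a
    | Inr (j, Some a) \<Rightarrow> T (\<sigma> J j, a)
    | Inr (j, None) \<Rightarrow> - (\<Sum>a\<in>UNIV. T (\<sigma> J j, a) * p a) - y (\<sigma> J j))" for y v
  have "D (asg y) = 0" for y
  proof -
    have "(\<lambda>y. D (asg y)) \<in> polyfun J"
    proof (rule polyfun_subst[OF D])
      fix v assume "v \<in> ?U"
      then obtain j b where v: "v = Inr (j, b)" "j < d" by auto
      show "(\<lambda>y. asg y v) \<in> polyfun J"
        by (cases b) (auto simp: asg_def v intro!: polyfun_intros \<sigma>_in[OF J v(2)])
    qed
    moreover have "(\<lambda>y. h i (asg y)) \<in> polyfun UNIV" for i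
    proof (rule polyfun_subst[OF h])
      fix v
      show "(\<lambda>y. asg y v) \<in> polyfun UNIV"
      proof (cases v)
        case (Inl a)
        then show ?thesis using point_poly by (simp add: asg_def)
      next
        case (Inr q)
        obtain j b where "q = (j, b)" by (cases q)
        then show ?thesis
          using Inr by (cases b) (auto simp: asg_def intro!: polyfun_intros)
      qed
    qed
    moreover have "D (asg y) = (\<Sum>i<length gs. h i (asg y) * (gs ! i) y)" for y
    proof -
      have hyper: "incidence_gens bs i (asg y) = 0" if "\<not> i < length bs" for i
        using that by (simp add: incidence_gens_def asg_def Tpoint)
      have "D (asg y) = (\<Sum>i<length bs. h i (asg y) * incidence_gens bs i (asg y))"
        unfolding sum using len hyper by (intro sum.mono_neutral_right) auto
      also have "\<dots> = (\<Sum>i<length gs. h i (asg y) * (gs ! i) y)"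
        by (intro sum.cong) (auto simp: gs_def incidence_gens_def asg_def)
      finally show ?thesis .
    qed
    ultimately show ?thesis
      using indep[of "\<lambda>y. D (asg y)" "\<lambda>i y. h i (asg y)" y] by simp
  qed
  \<comment> \<open>this \<open>y\<close> makes the constant terms those of \<open>w0\<close>\<close>
  moreover have "D (asg (\<lambda>b. - (\<Sum>a\<in>UNIV. T (b, a) * p a) - w0 (Inr (\<sigma>' J b, None)))) = D (asgT J T)"
    by (rule polyfun_cong[OF D]) (auto simp: asg_def asgT_def \<sigma>'[OF J] split: option.split)
  ultimately show False using T_D[OF J] by simp
qed

text \<open>The geometric form of Krull's height theorem.  A general choice of coefficients lifts to a zero of
  the incidence ideal, that is, to a point of \<open>V\<close> on the given hyperplanes.\<close>

theorem few_equations_meet_general_hyperplanes: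
  fixes bs :: "(('n::finite \<Rightarrow> complex) \<Rightarrow> complex) list"
  assumes bs: "\<And>b. b \<in> set bs \<Longrightarrow> b \<in> polyfun UNIV" and len: "length bs < CARD('n)"
    and V: "V = {x :: complex ^ 'n. \<forall>b\<in>set bs. b (\<lambda>i. x $ i) = 0}" and ne: "V \<noteq> {}"
  shows "meets_general_hyperplanes V (CARD('n) - length bs)"
proof -
  define d where "d = CARD('n) - length bs"
  obtain x0 where x0: "x0 \<in> V" using ne by blast
  let ?X = "range Inl :: 'n incidence_var set"
  let ?U = "Inr ` ({..<d} \<times> UNIV) :: 'n incidence_var set"
  let ?R = "polyfun (?U \<union> ?X)"
  let ?E = "ideal_gen ?R (CARD('n)) (incidence_gens bs)"
  have R: "is_subring ?R" by (rule polyfun_subring)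
  have gens: "incidence_gens bs i \<in> ?R" if i: "i < CARD('n)" for i
  proof (cases "i < length bs")
    case True
    have "(\<lambda>w. (bs ! i) (\<lambda>a. w (Inl a))) \<in> ?R"
      by (rule polyfun_subst[OF bs]) (use True in \<open>auto intro: polyfun.coord\<close>)
    then show ?thesis using True by (simp add: incidence_gens_def)
  next
    case False
    then have "i - length bs < d" using i by (simp add: d_def)
    then have "(\<lambda>w. (\<Sum>a\<in>UNIV. w (Inr (i - length bs, Some a)) * w (Inl a))
        + w (Inr (i - length bs, None))) \<in> ?R"
      by (intro polyfun_intros) auto
    then show ?thesis using False by (simp add: incidence_gens_def)
  qed
  have E: "ideal_on ?R ?E" by (rule ideal_on_ideal_gen[OF R gens])
  have "D = 0" if D: "D \<in> ?E" "D \<in> polyfun ?U" for D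
  proof -
    obtain h where h: "D = (\<Sum>i<CARD('n). h i * incidence_gens bs i)" "\<forall>i. h i \<in> ?R"
      using D(1) by (auto simp: ideal_gen_def)
    have "D w = (\<Sum>i<CARD('n). h i w * incidence_gens bs i w)" for w
      by (simp add: h(1) sum_fun_apply)
    moreover have "h i \<in> polyfun UNIV" for i
      using h(2) polyfun_mono[of "?U \<union> ?X" UNIV] by blast
    moreover have "b (\<lambda>i. x0 $ i) = 0" if "b \<in> set bs" for b using x0 that by (simp add: V)
    ultimately have "D w = 0" for w
      using incidence_elimination[OF bs _ len d_def D(2)] by blast
    then show ?thesis by (auto simp: fun_eq_iff)
  qed
  moreover have "finite ?X" "?X \<inter> ?U = {}" by auto
  ultimately have "\<exists>P\<in>polyfun ?U. P \<noteq> 0 \<and> (\<forall>w. P w \<noteq> 0 \<longrightarrow>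
      (\<exists>w'. (\<forall>i. i \<notin> ?X \<longrightarrow> w' i = w i) \<and> (\<forall>q\<in>?E. q w' = 0)))"
    using generic_point_of_ideal[OF _ _ E] by simp
  then obtain P where P: "P \<in> polyfun ?U" "P \<noteq> 0"
    and P_lift: "\<forall>w. P w \<noteq> 0 \<longrightarrow> (\<exists>w'. (\<forall>i. i \<notin> ?X \<longrightarrow> w' i = w i) \<and> (\<forall>q\<in>?E. q w' = 0))"
    by (elim bexE conjE)
  define ext :: "(nat \<times> 'n option \<Rightarrow> complex) \<Rightarrow> 'n incidence_var \<Rightarrow> complex" where
    "ext u v = (case v of Inl _ \<Rightarrow> 0 | Inr q \<Rightarrow> u q)" for u v
  have "(\<lambda>u. P (ext u)) \<in> polyfun ({..<d} \<times> UNIV)"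
  proof (rule polyfun_subst[OF P(1)])
    fix v assume "v \<in> ?U"
    then obtain q where q: "v = Inr q" "q \<in> {..<d} \<times> UNIV" by blast
    show "(\<lambda>u. ext u v) \<in> polyfun ({..<d} \<times> UNIV)"
      using polyfun.coord[OF q(2)] by (simp add: ext_def q(1))
  qed
  then obtain Pm where Pm: "mpoly_vars Pm \<subseteq> {..<d} \<times> UNIV" "\<And>u. P (ext u) = mpoly_eval Pm u"
    using polyfun_imp_mpoly by blast
  have "Pm \<noteq> 0"
  proof
    assume "Pm = 0"
    then have zero: "P (ext u) = 0" for u using Pm(2)[of u] by (simp add: mpoly_eval_def)
    have "P w = 0" for w
    proof -
      have "P w = P (ext (\<lambda>q. w (Inr q)))"
        by (rule polyfun_cong[OF P(1)]) (auto simp: ext_def)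
      then show ?thesis using zero by simp
    qed
    then show False using P(2) by (auto simp: fun_eq_iff)
  qed
  moreover have "V \<inter> (\<Inter>k<d. hyperplane u k) \<noteq> {}" if u: "mpoly_eval Pm u \<noteq> 0" for u
  proof -
    have "P (ext u) \<noteq> 0" using u Pm(2) by simp
    then obtain w where w: "\<forall>i. i \<notin> ?X \<longrightarrow> w i = ext u i" "\<forall>q\<in>?E. q w = 0"
      using P_lift by blast
    have wu: "w (Inr q) = u q" for q using w(1) by (auto simp: ext_def)
    have gen0: "incidence_gens bs i w = 0" if "i < CARD('n)" for i
      using w(2) ideal_gen_generator[OF R that] by blast
    define x :: "complex ^ 'n" where "x = (\<chi> i. w (Inl i))"
    have "x \<in> V"
      unfolding V
    proof (intro CollectI ballI)
      fix b assume "b \<in> set bs"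
      then obtain i where i: "i < length bs" "b = bs ! i" by (metis in_set_conv_nth)
      then show "b (\<lambda>i. x $ i) = 0"
        using gen0[of i] len by (simp add: incidence_gens_def x_def)
    qed
    moreover have "x \<in> hyperplane u k" if "k < d" for k
    proof -
      have "length bs + k < CARD('n)" using that by (simp add: d_def)
      then show ?thesis
        using gen0[of "length bs + k"] by (simp add: incidence_gens_def hyperplane_def x_def wu)
    qed
    ultimately show ?thesis by blast
  qed
  ultimately show ?thesis
    unfolding meets_general_hyperplanes_def holds_generally_def d_def[symmetric] using Pm(1) by blast
qed

text \<open>The coefficients of \<open>n + 1\<close> hyperplanes form a square matrix, and a common point, extended by the
  coordinate \<open>1\<close>, is a nonzero vector in its kernel.  The determinant does not vanish in general.\<close>

lemma meets_general_hyperplanes_bound: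
  fixes V :: "(complex ^ 'n::finite) set"
  assumes "meets_general_hyperplanes V d"
  shows "d \<le> CARD('n)"
proof (rule ccontr)
  assume d: "\<not> d \<le> CARD('n)"
  obtain P where P: "P \<noteq> 0" "\<And>u. mpoly_eval P u \<noteq> 0 \<Longrightarrow> V \<inter> (\<Inter>k<d. hyperplane u k) \<noteq> {}"
    using assms unfolding meets_general_hyperplanes_def holds_generally_def by blast
  have card: "card (UNIV :: 'n option set) = Suc CARD('n)" by (simp add: card_UNIV_option)
  obtain e :: "'n option \<Rightarrow> nat" where e: "bij_betw e UNIV {..<Suc CARD('n)}"
    using ex_bij_betw_finite_nat[of "UNIV :: 'n option set"] by (auto simp: card atLeast0LessThan)
  have e_less: "e a < d" for a
  proof -
    have "e a < Suc CARD('n)" using bij_betwE[OF e] by auto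
    then show ?thesis using d by linarith
  qed
  have e_inj: "e a = e b \<longleftrightarrow> a = b" for a b using bij_betw_imp_inj_on[OF e] by (auto simp: inj_on_def)
  define M :: "(nat \<times> 'n option \<Rightarrow> complex) \<Rightarrow> complex ^ 'n option ^ 'n option" where
    "M u = (\<chi> a b. u (e a, b))" for u
  have "(\<lambda>u. det (M u)) \<in> polyfun UNIV"
    by (rule polyfun_det) (simp add: M_def polyfun.coord)
  moreover have "M (\<lambda>(k, b). if k = e b then 1 else 0) = mat 1"
    by (simp add: M_def mat_def e_inj)
  then have "det (M (\<lambda>(k, b). if k = e b then 1 else 0)) \<noteq> 0" by simp
  moreover obtain x where "mpoly_eval P x \<noteq> 0" using mpoly_eval_nonzero[OF P(1)] by blast
  moreover have "mpoly_eval P \<in> polyfun (mpoly_vars P)" by (rule mpoly_eval_polyfun) simp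
  ultimately obtain u where u: "mpoly_eval P u \<noteq> 0" "det (M u) \<noteq> 0"
    using polyfun_common_nonzero[of "mpoly_eval P" _ _ "\<lambda>u. det (M u)"] by blast
  obtain x where x: "\<And>k. k < d \<Longrightarrow> x \<in> hyperplane u k" using P(2)[OF u(1)] by blast
  define y :: "complex ^ 'n option" where "y = (\<chi> b. case b of None \<Rightarrow> 1 | Some j \<Rightarrow> x $ j)"
  have "M u *v y = 0"
  proof (subst vec_eq_iff, intro allI)
    fix a
    have "(M u *v y) $ a = (\<Sum>b\<in>UNIV. u (e a, b) * y $ b)"
      by (simp add: matrix_vector_mult_def M_def)
    also have "\<dots> = u (e a, None) + (\<Sum>j\<in>UNIV. u (e a, Some j) * x $ j)"
      by (simp add: UNIV_option_conv sum.reindex y_def)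
    also have "\<dots> = 0" using x[OF e_less[of a]] by (simp add: hyperplane_def add.commute)
    finally show "(M u *v y) $ a = 0 $ a" by simp
  qed
  moreover obtain N where "N ** M u = mat 1"
    using u(2) invertible_det_nz[of "M u"] unfolding invertible_def by blast
  ultimately have "y = 0"
    by (metis matrix_vector_mul_assoc matrix_vector_mul_lid matrix_vector_mult_0_right)
  moreover have "y $ None = 1" by (simp add: y_def)
  ultimately show False by simp
qed

lemma variety_dim_ge:
  assumes "meets_general_hyperplanes V d" "V \<noteq> {}"
  shows "int d \<le> variety_dim V"
proof -
  have "finite {d. meets_general_hyperplanes V d}"
    by (rule finite_subset[of _ "{..CARD('a)}"]) (auto intro: meets_general_hyperplanes_bound)
  then show ?thesis using assms by (simp add: variety_dim_def)
qed

section \<open>Linear spans and exact regions\<close>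

lemma cxh_ev_mscale: "cxh.ev (mscale c p) x = complex_of_real c * cxh.ev p x"
  by (simp add: mscale_def cxh.ev_mult)

lemma gen_ideal_contains: "set F \<subseteq> gen_ideal F"
  for F :: "('v, 'a::comm_ring_1) mpoly list"
proof
  fix f assume "f \<in> set F"
  then obtain i where i: "i < length F" "f = F ! i" by (metis in_set_conv_nth)
  then have "f = (\<Sum>j<length F. (if j = i then 1 else 0) * F ! j)"
    by (simp add: if_distrib[of "\<lambda>t. t * _"] cong: if_cong)
  then show "f \<in> gen_ideal F"
    unfolding gen_ideal_def by (intro CollectI exI[of _ "\<lambda>j. if j = i then 1 else 0"]) simp
qed

lemma (in coefficient_hom) zeros_gen_ideal:
  "(\<forall>f\<in>set F. ev f x = 0) \<longleftrightarrow> (\<forall>f\<in>gen_ideal F. ev f x = 0)"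
  using gen_ideal_contains[of F] by (auto simp: gen_ideal_def ev_sum ev_mult)

lemma real_variety_eq: "gen_ideal F = gen_ideal G \<Longrightarrow> real_variety F = real_variety G"
  unfolding real_variety_def mpoly_eval_eq_ev by (simp add: idh.zeros_gen_ideal)

lemma complex_variety_eq: "gen_ideal F = gen_ideal G \<Longrightarrow> complex_variety F = complex_variety G"
  unfolding complex_variety_def mpoly_eval_complexify by (simp add: cxh.zeros_gen_ideal)

lemma real_point_complex:
  assumes "x \<in> real_variety F"
  shows "(\<chi> i. complex_of_real (x $ i)) \<in> complex_variety F"
proof -
  have "monomial_val m (\<lambda>i. complex_of_real (x $ i)) = complex_of_real (monomial_val m (\<lambda>i. x $ i))" for m
    by (simp add: monomial_val_def)
  then have "cxh.ev f (\<lambda>i. complex_of_real (x $ i)) = complex_of_real (idh.ev f (\<lambda>i. x $ i))" for f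
    by (simp add: cxh.ev_def idh.ev_def)
  moreover have coords: "($) (\<chi> i. complex_of_real (x $ i)) = (\<lambda>i. complex_of_real (x $ i))"
    by (rule ext) simp
  ultimately show ?thesis
    using assms unfolding complex_variety_def mpoly_eval_complexify
    by (simp add: real_variety_def mpoly_eval_eq_ev coords)
qed

lemma span_set_list:
  fixes G :: "('v, 'a::field) mpoly list"
  assumes "f \<in> mpv.span (set G)"
  shows "\<exists>\<mu>. f = (\<Sum>i<length G. mscale (\<mu> i) (G ! i))"
  using assms
proof (induction rule: mpv.span_induct_alt)
  case base
  show ?case by (intro exI[of _ "\<lambda>_. 0"]) simp
next
  case (step c x y)
  then obtain \<mu> where \<mu>: "y = (\<Sum>i<length G. mscale (\<mu> i) (G ! i))" by blast
  obtain j where j: "j < length G" "x = G ! j" using step by (metis in_set_conv_nth)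
  have "mscale c x + y = (\<Sum>i<length G. mscale (\<mu> i + (if i = j then c else 0)) (G ! i))"
    using j by (simp add: \<mu> mpv.scale_left_distrib sum.distrib add.commute
        if_distrib[of "\<lambda>t. mscale t _"] cong: if_cong)
  then show ?case by (rule exI[of _ "\<lambda>i. \<mu> i + (if i = j then c else 0)"])
qed

lemma quad_mat_sum: "quad_mat (\<Sum>i\<in>A. mscale (l i) (f i)) = (\<Sum>i\<in>A. l i *\<^sub>R quad_mat (f i))"
  by (simp add: quad_mat_def vec_eq_iff lookup_sum Let_def sum_divide_distrib)

lemma quad_vec_sum: "quad_vec (\<Sum>i\<in>A. mscale (l i) (f i)) = (\<Sum>i\<in>A. l i *\<^sub>R quad_vec (f i))"
  by (simp add: quad_vec_def vec_eq_iff lookup_sum sum_divide_distrib)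

text \<open>Reading off the matrix and the vector of a polynomial is linear.  So multipliers \<open>l\<close> for \<open>F\<close> can be
  exchanged for the coefficients \<open>\<mu>\<close> of the same combination in terms of \<open>G\<close>.\<close>

lemma sdp_exact_region_mono:
  assumes span: "mpv.span (set F) \<subseteq> mpv.span (set G)" and V: "real_variety F \<subseteq> real_variety G"
  shows "sdp_exact_region F \<subseteq> sdp_exact_region G"
proof safe
  fix C c assume "(C, c) \<in> sdp_exact_region F"
  then obtain x l where *: "symmetric_mat C" "x \<in> real_variety F" "pos_definite (sdp_hessian F C l)"
    "c - (\<Sum>i<length F. l i *\<^sub>R quad_vec (F ! i)) + sdp_hessian F C l *v x = 0"
    by (auto simp: sdp_exact_region_def)
  have "(\<Sum>i<length F. mscale (l i) (F ! i)) \<in> mpv.span (set F)"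
    by (intro mpv.span_sum mpv.span_scale mpv.span_base) simp
  then obtain \<mu> where \<mu>: "(\<Sum>i<length F. mscale (l i) (F ! i)) = (\<Sum>i<length G. mscale (\<mu> i) (G ! i))"
    using span span_set_list by blast
  have "sdp_hessian F C l = sdp_hessian G C \<mu>"
    using arg_cong[OF \<mu>, of quad_mat] by (simp add: sdp_hessian_def quad_mat_sum)
  moreover have "(\<Sum>i<length F. l i *\<^sub>R quad_vec (F ! i)) = (\<Sum>i<length G. \<mu> i *\<^sub>R quad_vec (G ! i))"
    using arg_cong[OF \<mu>, of quad_vec] by (simp add: quad_vec_sum)
  ultimately show "(C, c) \<in> sdp_exact_region G"
    using * V by (auto simp: sdp_exact_region_def)
qed

text \<open>A basis \<open>B\<close> of the span of \<open>G\<close> has fewer than \<open>length F\<close> members if the span of \<open>F\<close> is larger, and it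
  cuts out the same complex variety as \<open>F\<close>.\<close>

lemma span_eq_of_complete_intersection:
  fixes F G :: "('n::finite, real) mpoly list"
  assumes dim: "variety_dim (complex_variety F) = int CARD('n) - int (length F)"
    and ne: "complex_variety F \<noteq> {}"
    and GF: "set G \<subseteq> mpv.span (set F)" and ideal: "gen_ideal F = gen_ideal G"
  shows "mpv.span (set F) \<subseteq> mpv.span (set G)"
proof (rule ccontr)
  assume not_sub: "\<not> ?thesis"
  obtain B where B: "B \<subseteq> set G" "mpv.independent B" "set G \<subseteq> mpv.span B"
    using mpv.basis_exists[of "set G"] by metis
  have finB: "finite B" using B(1) finite_subset by blast
  have spanB: "mpv.span B = mpv.span (set G)"
    using mpv.span_mono[OF B(1)] mpv.span_minimal[OF B(3) mpv.subspace_span] by auto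
  obtain f where f: "f \<in> set F" "f \<notin> mpv.span B"
    using not_sub spanB mpv.span_minimal[OF _ mpv.subspace_span, of "set F" "set G"] by auto
  have "mpv.independent (insert f B)"
    using B(2) f(2) by (simp add: mpv.independent_insert)
  moreover have "insert f B \<subseteq> mpv.span (set F)"
    using f(1) B(1) GF mpv.span_base by auto
  ultimately have "card (insert f B) \<le> card (set F)"
    using mpv.independent_span_bound[of "set F"] by blast
  moreover have "f \<notin> B" using f(2) mpv.span_base by blast
  ultimately have card_B: "card B < length F"
    using finB card_length[of F] by simp
  obtain bl where bl: "set bl = B" "distinct bl" using finite_distinct_list[OF finB] by blast
  have len: "length bl = card B" using distinct_card[OF bl(2)] bl(1) by simp
  have len_F: "length F \<le> CARD('n)"
    using dim ne by (simp add: variety_dim_def split: if_splits)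
  let ?V = "complex_variety F"
  let ?bs = "map cxh.ev bl :: (('n \<Rightarrow> complex) \<Rightarrow> complex) list"
  have zeros: "(\<forall>g\<in>set G. cxh.ev g x = 0) \<longleftrightarrow> (\<forall>b\<in>B. cxh.ev b x = 0)" for x :: "'n \<Rightarrow> complex"
  proof
    assume *: "\<forall>b\<in>B. cxh.ev b x = 0"
    have "cxh.ev g x = 0" if "g \<in> mpv.span B" for g
      using that by (induction rule: mpv.span_induct_alt) (simp_all add: cxh.ev_add cxh_ev_mscale *)
    then show "\<forall>g\<in>set G. cxh.ev g x = 0" using B(3) by blast
  qed (use B(1) in blast)
  have V: "?V = {x. \<forall>b\<in>set ?bs. b (\<lambda>i. x $ i) = 0}"
    unfolding complex_variety_eq[OF ideal] unfolding complex_variety_def mpoly_eval_complexify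
    by (simp add: zeros bl(1))
  have "meets_general_hyperplanes ?V (CARD('n) - length ?bs)"
  proof (rule few_equations_meet_general_hyperplanes[OF _ _ V ne])
    show "b \<in> polyfun UNIV" if "b \<in> set ?bs" for b using that ev_polyfun[of _ UNIV] by auto
    show "length ?bs < CARD('n)" using card_B len len_F by simp
  qed
  from variety_dim_ge[OF this ne] have "int (CARD('n) - card B) \<le> int CARD('n) - int (length F)"
    using dim len by simp
  then show False using card_B len_F by linarith
qed

theorem proposition2p3:
  fixes F G :: "('n::finite, real) mpoly list"
  assumes "set F \<subseteq> mpolys_deg_le 2"
    and "set G \<subseteq> mpolys_deg_le 2"
    and "variety_dim (complex_variety F) = int CARD('n) - int (length F)"
    and "\<forall>g\<in>set G. \<exists>\<mu> :: nat \<Rightarrow> real. g = (\<Sum>i<length F. mpoly_const (\<mu> i) * F ! i)"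
    and "gen_ideal F = gen_ideal G"
  shows "sdp_exact_region F = sdp_exact_region G"
proof -
  have V: "real_variety F = real_variety G" by (rule real_variety_eq) fact
  have GF: "set G \<subseteq> mpv.span (set F)"
  proof
    fix g assume "g \<in> set G"
    then obtain \<mu> :: "nat \<Rightarrow> real" where "g = (\<Sum>i<length F. mscale (\<mu> i) (F ! i))"
      using assms(4) unfolding mscale_def by blast
    moreover have "(\<Sum>i<length F. mscale (\<mu> i) (F ! i)) \<in> mpv.span (set F)"
      by (intro mpv.span_sum mpv.span_scale mpv.span_base) simp
    ultimately show "g \<in> mpv.span (set F)" by simp
  qed
  show ?thesis
  proof (cases "real_variety F = {}")
    case True
    then show ?thesis using V by (simp add: sdp_exact_region_def)
  next
    case False
    then have "complex_variety F \<noteq> {}" using real_point_complex by blast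
    from span_eq_of_complete_intersection[OF assms(3) this GF assms(5)]
    have "mpv.span (set F) = mpv.span (set G)"
      using mpv.span_minimal[OF GF mpv.subspace_span] by auto
    then show ?thesis using V by (intro antisym sdp_exact_region_mono) auto
  qed
qed

end
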